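(* Let $X$ be a Banach space, let $A$ be the generator of a strongly continuous semigroup $T$ of bounded linear operators on $X$, let $U$ be a normed linear space, and let $\mathcal{U}:=PC(\mathbb{R}_+,U)$. Consider the system $$\dot x(t)=Ax(t)+f(x(t),u(t)),\qquad x(t)\in X,\ u(t)\in U,$$ where $f:X\times U\to X$ is Lipschitz continuous on bounded subsets of $X$ and $f(x,\cdot)$ is continuous for every $x\in X$. Assume that for every initial state in $X$ and every $u\in\mathcal{U}$ the mild solution exists and is unique on $\mathbb{R}_+$, and that the system is BRS. Then the following statements are equivalent: (i) The system is ISpS. (ii) For every $s>0$ there is a bounded nonempty $s$-invariant set $\mathcal{A}\subset X$ such that the system is ISS with respect to $\mathcal{A}$. (iii) There is a bounded nonempty set $\mathcal{A}\subset X$ such that the system is ULIM with respect to $\mathcal{A}$.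
   Context: Notation: $\mathbb{R}_+=[0,\infty)$. $PC(\mathbb{R}_+,U)$ is the space of globally bounded, piecewise continuous, right continuous functions $u:\mathbb{R}_+\to U$ with norm $\|u\|_{\mathcal{U}}:=\sup_{t\ge0}\|u(t)\|_U$. A mild solution on $[0,\tau]$ is $x\in C([0,\tau],X)$ satisfying $x(t)=T(t)x(0)+\int_0^tT(t-s)f(x(s),u(s))\,ds$. $\phi(t,x,u)$ denotes the value at time $t$ of the mild solution with initial state $x$ and input $u$. $f$ is Lipschitz continuous on bounded subsets of $X$: for every $C>0$ there is $L_f(C)>0$ such that $\|f(x,v)-f(y,v)\|\le L_f(C)\|x-y\|$ for all $x,y\in X$ with $\|x\|,\|y\|\le C$ and all $v\in U$ with $\|v\|_U\le C$. For nonempty $\mathcal{A}\subset X$, $\|x\|_{\mathcal{A}}:=\inf_{y\in\mathcal{A}}\|x-y\|$. $\mathcal{K}$: continuous strictly increasing $\gamma:\mathbb{R}_+\to\mathbb{R}_+$ with $\gamma(0)=0$; $\mathcal{K}_\infty$: unbounded elements of $\mathcal{K}$; $\mathcal{L}$: continuous strictly decreasing $\gamma:\mathbb{R}_+\to\mathbb{R}_+$ with $\lim_{t\to\infty}\gamma(t)=0$; $\mathcal{KL}$: continuous $\beta:\mathbb{R}_+\times\mathbb{R}_+\to\mathbb{R}_+$ with $\beta(\cdot,t)\in\mathcal{K}$ for all $t\ge0$ and $\beta(r,\cdot)\in\mathcal{L}$ for all $r>0$. BRS (bounded reachability sets): for all $C>0$, $\tau>0$: $\sup\{\|\phi(t,x,u)\|:\|x\|\le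 C,\|u\|_{\mathcal{U}}\le C,t\in[0,\tau]\}<\infty$. For $s>0$, $\mathcal{A}$ is $s$-invariant if $\phi(t,x,u)\in\mathcal{A}$ for all $t\ge0$, $x\in\mathcal{A}$ and $u\in\mathcal{U}$ with $\|u\|_{\mathcal{U}}\le s$. ISpS w.r.t. $\mathcal{A}$: there exist $\beta\in\mathcal{KL}$, $\gamma\in\mathcal{K}_\infty$, $c>0$ such that $\|\phi(t,x,u)\|_{\mathcal{A}}\le\beta(\|x\|_{\mathcal{A}},t)+\gamma(\|u\|_{\mathcal{U}})+c$ for all $x\in X,u\in\mathcal{U},t\ge0$. ISS w.r.t. $\mathcal{A}$: the same estimate with $c=0$. The system is ISpS if it is ISpS w.r.t. some bounded nonempty $\mathcal{A}\subset X$. ULIM w.r.t. $\mathcal{A}$: there is $\gamma\in\mathcal{K}_\infty$ such that for all $\varepsilon>0$, $r>0$ there is $\tau=\tau(\varepsilon,r)<\infty$ such that for all $u\in\mathcal{U}$ and all $x\in X$ with $\|x\|_{\mathcal{A}}\le r$ there exists $t\le\tau$ ($t\ge 0$) with $\|\phi(t,x,u)\|_{\mathcal{A}}\le\varepsilon+\gamma(\|u\|_{\mathcal{U}})$. *)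

theory Defs
  imports "HOL-Analysis.Analysis"
begin

text \<open>
  Functions on the half-line are modelled as functions on \<^typ>\<open>real\<close>; every notion below
  only constrains and only inspects their values at nonnegative arguments.
\<close>

subsection \<open>Strongly continuous semigroups and their generators\<close>

definition C0_semigroup :: "(real \<Rightarrow> 'a::real_normed_vector \<Rightarrow> 'a) \<Rightarrow> bool" where
  "C0_semigroup T \<longleftrightarrow>
     (\<forall>t\<ge>0. bounded_linear (T t)) \<and>
     (\<forall>x. T 0 x = x) \<and>
     (\<forall>s\<ge>0. \<forall>t\<ge>0. \<forall>x. T (s + t) x = T s (T t x)) \<and>
     (\<forall>x. ((\<lambda>t. T t x) \<longlongrightarrow> x) (at_right 0))"

text \<open>The unbounded operator is a domain \<open>D\<close> together with a map \<open>A\<close>, relevant only on \<open>D\<close>.\<close>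

definition generator_of ::
    "'a::real_normed_vector set \<Rightarrow> ('a \<Rightarrow> 'a) \<Rightarrow> (real \<Rightarrow> 'a \<Rightarrow> 'a) \<Rightarrow> bool" where
  "generator_of D A T \<longleftrightarrow>
     D = {x. \<exists>y. ((\<lambda>h. (T h x - x) /\<^sub>R h) \<longlongrightarrow> y) (at_right 0)} \<and>
     (\<forall>x\<in>D. ((\<lambda>h. (T h x - x) /\<^sub>R h) \<longlongrightarrow> A x) (at_right 0))"

subsection \<open>Inputs and mild solutions\<close>

text \<open>
  Piecewise continuity: finitely many discontinuities on each compact interval, with
  one-sided limits at all points (the right limits being given by right continuity).
\<close>

definition PC :: "(real \<Rightarrow> 'u::real_normed_vector) set" where
  "PC = {u. bounded (u ` {0..}) \<and>
            (\<forall>b. finite {t\<in>{0..b}. \<not> continuous (at t within {0..}) u}) \<and>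
            (\<forall>t>0. \<exists>l. (u \<longlongrightarrow> l) (at_left t)) \<and>
            (\<forall>t\<ge>0. continuous (at_right t) u)}"

definition input_norm :: "(real \<Rightarrow> 'u::real_normed_vector) \<Rightarrow> real" where
  "input_norm u = (SUP t\<in>{0..}. norm (u t))"

definition lipschitz_on_bounded ::
    "('a::real_normed_vector \<Rightarrow> 'u::real_normed_vector \<Rightarrow> 'a) \<Rightarrow> bool" where
  "lipschitz_on_bounded f \<longleftrightarrow>
     (\<forall>C>0. \<exists>L>0. \<forall>x y v. norm x \<le> C \<and> norm y \<le> C \<and> norm v \<le> C \<longrightarrow>
        norm (f x v - f y v) \<le> L * norm (x - y))"

text \<open>
  The integral is the Henstock--Kurzweil integral, available in every Banach space; for the
  piecewise continuous integrands arising here it is the Riemann (and Bochner) integral.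
\<close>

definition mild_solution_on ::
    "(real \<Rightarrow> 'a::banach \<Rightarrow> 'a) \<Rightarrow> ('a \<Rightarrow> 'u::real_normed_vector \<Rightarrow> 'a) \<Rightarrow>
     (real \<Rightarrow> 'u) \<Rightarrow> real \<Rightarrow> (real \<Rightarrow> 'a) \<Rightarrow> bool" where
  "mild_solution_on T f u \<tau> \<xi> \<longleftrightarrow>
     continuous_on {0..\<tau>} \<xi> \<and>
     (\<forall>t\<in>{0..\<tau>}. (\<lambda>s. T (t - s) (f (\<xi> s) (u s))) integrable_on {0..t} \<and>
        \<xi> t = T t (\<xi> 0) + integral {0..t} (\<lambda>s. T (t - s) (f (\<xi> s) (u s))))"

definition global_mild_solution ::
    "(real \<Rightarrow> 'a::banach \<Rightarrow> 'a) \<Rightarrow> ('a \<Rightarrow> 'u::real_normed_vector \<Rightarrow> 'a) \<Rightarrow>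
     'a \<Rightarrow> (real \<Rightarrow> 'u) \<Rightarrow> (real \<Rightarrow> 'a) \<Rightarrow> bool" where
  "global_mild_solution T f x u \<xi> \<longleftrightarrow> \<xi> 0 = x \<and> (\<forall>\<tau>>0. mild_solution_on T f u \<tau> \<xi>)"

definition unique_global_solutions ::
    "(real \<Rightarrow> 'a::banach \<Rightarrow> 'a) \<Rightarrow> ('a \<Rightarrow> 'u::real_normed_vector \<Rightarrow> 'a) \<Rightarrow> bool" where
  "unique_global_solutions T f \<longleftrightarrow>
     (\<forall>x. \<forall>u\<in>PC. (\<exists>\<xi>. global_mild_solution T f x u \<xi>) \<and>
        (\<forall>\<xi> \<eta>. global_mild_solution T f x u \<xi> \<and> global_mild_solution T f x u \<eta> \<longrightarrow>
           (\<forall>t\<ge>0. \<xi> t = \<eta> t)))"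

text \<open>The value at time \<open>t \<ge> 0\<close> of the mild solution; meaningful when that value is unique.\<close>

definition mild_flow ::
    "(real \<Rightarrow> 'a::banach \<Rightarrow> 'a) \<Rightarrow> ('a \<Rightarrow> 'u::real_normed_vector \<Rightarrow> 'a) \<Rightarrow>
     real \<Rightarrow> 'a \<Rightarrow> (real \<Rightarrow> 'u) \<Rightarrow> 'a" where
  "mild_flow T f t x u = (THE y. \<exists>\<xi>. global_mild_solution T f x u \<xi> \<and> y = \<xi> t)"

subsection \<open>Comparison functions\<close>

definition class_K :: "(real \<Rightarrow> real) set" where
  "class_K = {\<gamma>. \<gamma> ` {0..} \<subseteq> {0..} \<and> continuous_on {0..} \<gamma> \<and> strict_mono_on {0..} \<gamma> \<and> \<gamma> 0 = 0}"

definition class_K_inf :: "(real \<Rightarrow> real) set" where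
  "class_K_inf = {\<gamma>\<in>class_K. \<not> bounded (\<gamma> ` {0..})}"

definition class_L :: "(real \<Rightarrow> real) set" where
  "class_L = {\<gamma>. \<gamma> ` {0..} \<subseteq> {0..} \<and> continuous_on {0..} \<gamma> \<and>
                 (\<forall>s\<ge>0. \<forall>t>s. \<gamma> t < \<gamma> s) \<and> (\<gamma> \<longlongrightarrow> 0) at_top}"

definition class_KL :: "(real \<Rightarrow> real \<Rightarrow> real) set" where
  "class_KL = {\<beta>. continuous_on ({0..} \<times> {0..}) (\<lambda>(r, t). \<beta> r t) \<and>
                  (\<forall>t\<ge>0. (\<lambda>r. \<beta> r t) \<in> class_K) \<and>
                  (\<forall>r>0. \<beta> r \<in> class_L)}"

subsection \<open>Stability notions\<close>

text \<open>
  These are stated for a flow map \<open>\<phi> t x u\<close> with inputs in \<^const>\<open>PC\<close>.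
  The distance of \<open>x\<close> to a nonempty set \<open>A\<close> is \<^term>\<open>infdist x A\<close>.
\<close>

definition BRS ::
    "(real \<Rightarrow> 'a::real_normed_vector \<Rightarrow> (real \<Rightarrow> 'u::real_normed_vector) \<Rightarrow> 'a) \<Rightarrow> bool" where
  "BRS \<phi> \<longleftrightarrow>
     (\<forall>C>0. \<forall>\<tau>>0. bdd_above {norm (\<phi> t x u) | t x u.
        norm x \<le> C \<and> u \<in> PC \<and> input_norm u \<le> C \<and> t \<in> {0..\<tau>}})"

definition s_invariant ::
    "(real \<Rightarrow> 'a::real_normed_vector \<Rightarrow> (real \<Rightarrow> 'u::real_normed_vector) \<Rightarrow> 'a) \<Rightarrow>
     real \<Rightarrow> 'a set \<Rightarrow> bool" where
  "s_invariant \<phi> s A \<longleftrightarrow>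
     (\<forall>t\<ge>0. \<forall>x\<in>A. \<forall>u\<in>PC. input_norm u \<le> s \<longrightarrow> \<phi> t x u \<in> A)"

definition ISpS_wrt ::
    "(real \<Rightarrow> 'a::real_normed_vector \<Rightarrow> (real \<Rightarrow> 'u::real_normed_vector) \<Rightarrow> 'a) \<Rightarrow>
     'a set \<Rightarrow> bool" where
  "ISpS_wrt \<phi> A \<longleftrightarrow>
     (\<exists>\<beta>\<in>class_KL. \<exists>\<gamma>\<in>class_K_inf. \<exists>c>0. \<forall>x. \<forall>u\<in>PC. \<forall>t\<ge>0.
        infdist (\<phi> t x u) A \<le> \<beta> (infdist x A) t + \<gamma> (input_norm u) + c)"

definition ISS_wrt ::
    "(real \<Rightarrow> 'a::real_normed_vector \<Rightarrow> (real \<Rightarrow> 'u::real_normed_vector) \<Rightarrow> 'a) \<Rightarrow>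
     'a set \<Rightarrow> bool" where
  "ISS_wrt \<phi> A \<longleftrightarrow>
     (\<exists>\<beta>\<in>class_KL. \<exists>\<gamma>\<in>class_K_inf. \<forall>x. \<forall>u\<in>PC. \<forall>t\<ge>0.
        infdist (\<phi> t x u) A \<le> \<beta> (infdist x A) t + \<gamma> (input_norm u))"

definition ISpS ::
    "(real \<Rightarrow> 'a::real_normed_vector \<Rightarrow> (real \<Rightarrow> 'u::real_normed_vector) \<Rightarrow> 'a) \<Rightarrow> bool" where
  "ISpS \<phi> \<longleftrightarrow> (\<exists>A. bounded A \<and> A \<noteq> {} \<and> ISpS_wrt \<phi> A)"

definition ULIM_wrt ::
    "(real \<Rightarrow> 'a::real_normed_vector \<Rightarrow> (real \<Rightarrow> 'u::real_normed_vector) \<Rightarrow> 'a) \<Rightarrow>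
     'a set \<Rightarrow> bool" where
  "ULIM_wrt \<phi> A \<longleftrightarrow>
     (\<exists>\<gamma>\<in>class_K_inf. \<forall>\<epsilon>>0. \<forall>r>0. \<exists>\<tau>. \<forall>u\<in>PC. \<forall>x. infdist x A \<le> r \<longrightarrow>
        (\<exists>t\<in>{0..\<tau>}. infdist (\<phi> t x u) A \<le> \<epsilon> + \<gamma> (input_norm u)))"

end

theory Submission
  imports Defs
begin

text \<open>
  Relative to a large ball, ISpS implies ULIM, because the offset can be absorbed into the
  ball. For ULIM \<open>\<Longrightarrow>\<close> (ii), ULIM makes every trajectory return, within uniform time,
  to a ball whose radius \<open>\<rho>\<close> depends only on the input norm; with BRS this bounds all
  trajectories uniformly. The set \<open>S\<close> of all states reachable from the ball of radius \<open>\<rho> s\<close> with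
  inputs of norm at most \<open>s\<close> is then bounded and \<open>s\<close>-invariant. For inputs below \<open>s\<close>, trajectories
  enter \<open>S\<close> in finite time, and until then the distance to \<open>S\<close> is at most a multiple of
  the initial distance, as the flow is Lipschitz in the state (Gronwall). For larger
  inputs one has the uniform bounds, which are absorbed by \<open>\<gamma>\<close> when the input
  dominates the initial distance, and by \<open>\<beta>\<close> until the return time otherwise.
\<close>

section \<open>Analytic preliminaries\<close>

text \<open>Multiply the integral bound \<open>a + K * integral {0..t} e\<close> by the integrating
  factor \<open>exp (- K * t)\<close>. Continuity of \<open>e\<close> makes the product
  \<open>g\<close> differentiable inside the interval, and the assumed inequality says exactly that
  its derivative is nonpositive. So \<open>g\<close> stays below \<open>g 0 = a\<close>.\<close>

lemma gronwall:
  fixes e :: "real \<Rightarrow> real"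
  assumes "continuous_on {0..\<tau>} e" "K \<ge> 0"
    and le: "\<And>t. t \<in> {0..\<tau>} \<Longrightarrow> e t \<le> a + K * integral {0..t} e"
    and t: "t \<in> {0..\<tau>}"
  shows "e t \<le> a * exp (K * t)"
proof -
  define g where "g = (\<lambda>t. (a + K * integral {0..t} e) * exp (- K * t))"
  have "g t \<le> g 0"
  proof (rule DERIV_nonpos_imp_decreasing_open[of 0 t g])
    show "0 \<le> t" using t by simp
    have "continuous_on {0..t} e"
      using assms(1) t by (auto intro: continuous_on_subset)
    then have "continuous_on {0..t} (\<lambda>x. integral {0..x} e)"
      by (intro indefinite_integral_continuous_1 integrable_continuous_interval)
    then show "continuous_on {0..t} g"
      unfolding g_def by (intro continuous_intros)
    show "\<exists>y. (g has_real_derivative y) (at x) \<and> y \<le> 0" if x: "0 < x" "x < t" for x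
    proof -
      have "((\<lambda>x. integral {0..x} e) has_real_derivative e x) (at x within {0..\<tau>})"
        using x t by (intro integral_has_real_derivative assms) auto
      moreover have "at x within {0..\<tau>} = at x"
        using x t by (intro at_within_interior) auto
      ultimately have "((\<lambda>x. integral {0..x} e) has_real_derivative e x) (at x)"
        by simp
      then have "(g has_real_derivative K * (e x - (a + K * integral {0..x} e)) * exp (- K * x)) (at x)"
        unfolding g_def by (auto intro!: derivative_eq_intros simp: algebra_simps)
      moreover have "K * (e x - (a + K * integral {0..x} e)) * exp (- K * x) \<le> 0"
        using le[of x] x t \<open>K \<ge> 0\<close> by (simp add: mult_nonneg_nonpos mult_nonpos_nonneg)
      ultimately show ?thesis by blast
    qed
  qed
  then have "g t * exp (K * t) \<le> a * exp (K * t)"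
    by (simp add: g_def)
  moreover have "g t * exp (K * t) = a + K * integral {0..t} e"
    by (simp add: g_def mult.assoc flip: exp_add)
  ultimately show ?thesis
    using le[OF t] by simp
qed

text \<open>
  Uniform boundedness by Baire: the closed sets of states whose orbit on \<open>[0, 1 / (n + 1)]\<close> is
  bounded by \<open>n + 1\<close> cover the space.
\<close>

lemma C0_semigroup_bounded_near_0:
  fixes T :: "real \<Rightarrow> 'a::banach \<Rightarrow> 'a"
  assumes "C0_semigroup T"
  shows "\<exists>d>0. \<exists>M>0. \<forall>t\<in>{0..d}. \<forall>x. norm (T t x) \<le> M * norm x"
proof -
  have lin: "bounded_linear (T t)" if "t \<ge> 0" for t
    using assms that by (simp add: C0_semigroup_def)
  define F where "F = (\<lambda>n::nat. {x. \<forall>t\<in>{0..1 / Suc n}. norm (T t x) \<le> Suc n})"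
  have closed: "closed (F n)" for n
  proof -
    have "F n = (\<Inter>t\<in>{0..1 / Suc n}. {x. norm (T t x) \<le> Suc n})"
      by (auto simp: F_def)
    moreover have "closed {x. norm (T t x) \<le> Suc n}" if "t \<in> {0..1 / Suc n}" for t
      using that by (intro closed_Collect_le continuous_intros bounded_linear.continuous_on[OF lin]) auto
    ultimately show ?thesis by auto
  qed
  have cover: "\<exists>n. x \<in> F n" for x
  proof -
    have "((\<lambda>t. norm (T t x)) \<longlongrightarrow> norm x) (at_right 0)"
      using assms by (intro tendsto_norm) (simp add: C0_semigroup_def)
    then have "\<forall>\<^sub>F t in at_right 0. norm (T t x) < norm x + 1"
      by (rule order_tendstoD) simp
    then obtain b where b: "b > 0" "\<And>t. 0 < t \<Longrightarrow> t < b \<Longrightarrow> norm (T t x) < norm x + 1"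
      by (auto simp: eventually_at_right_field)
    obtain m where m: "norm x + 1 < real m" using reals_Archimedean2 by blast
    obtain k where k: "k > 0" "1 / real k < b"
      using \<open>b > 0\<close> by (metis nat_approx_posE of_nat_0_less_iff zero_less_Suc)
    \<comment> \<open>The index serves two purposes: \<open>m\<close> bounds the orbit near zero,
      and \<open>k\<close> makes the time interval short enough for that bound to apply. Time
      \<open>0\<close> lies outside the right-sided filter and is treated through
      \<open>T 0 x = x\<close>.\<close>
    have "x \<in> F (m + k)"
      unfolding F_def
    proof safe
      fix t assume "t \<in> {0..1 / real (Suc (m + k))}"
      moreover have "1 / real (Suc (m + k)) \<le> 1 / real k"
        using k(1) by (intro divide_left_mono) auto
      ultimately have t: "0 \<le> t" "t < b" using k(2) by auto
      have "T 0 x = x" using assms by (simp add: C0_semigroup_def)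
      then have "norm (T t x) < norm x + 1"
        using b(2)[of t] t by (cases "t = 0") auto
      then show "norm (T t x) \<le> real (Suc (m + k))" using m by simp
    qed
    then show ?thesis by blast
  qed
  have "\<exists>n. interior (F n) \<noteq> {}"
  proof (rule ccontr)
    assume "\<not> ?thesis"
    then have "euclidean interior_of \<Union>(range F) = {}"
      by (intro Baire_category_alt) (auto simp: closed completely_metrizable_space_euclidean)
    moreover have "\<Union>(range F) = UNIV" using cover by auto
    ultimately show False by simp
  qed
  then obtain n z where "z \<in> interior (F n)" by auto
  then obtain r where r: "r > 0" "cball z r \<subseteq> F n"
    by (meson interior_subset mem_interior_cball subset_trans)
  \<comment> \<open>The ball of radius \<open>r\<close> about \<open>z\<close> lies in
    \<open>F n\<close>. Hence \<open>T t\<close> moves any vector of length \<open>r\<close>, being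
    a difference of two points of that ball, to norm at most \<open>2 * Suc n\<close>; linearity
    rescales this to all vectors.\<close>
  define M where "M = 2 * real (Suc n) / r"
  have "norm (T t x) \<le> M * norm x" if t: "t \<in> {0..1 / Suc n}" for t x
  proof (cases "x = 0")
    case True
    then show ?thesis using lin[of t] t by (simp add: linear_0 bounded_linear.linear)
  next
    case False
    interpret bounded_linear "T t" using lin t by simp
    define y where "y = z + (r / norm x) *\<^sub>R x"
    have "y \<in> F n" "z \<in> F n"
      using r False by (auto simp: y_def dist_norm intro!: subsetD[OF r(2)])
    then have "norm (T t y) \<le> Suc n" "norm (T t z) \<le> Suc n"
      using t unfolding F_def by blast+
    then have "norm (T t y - T t z) \<le> 2 * real (Suc n)"
      by (intro order_trans[OF norm_triangle_ineq4]) (simp only: mult_2 add_mono)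
    moreover have "T t y - T t z = (r / norm x) *\<^sub>R T t x"
      by (simp add: y_def add scaleR)
    ultimately have "r / norm x * norm (T t x) \<le> 2 * real (Suc n)"
      using r(1) by simp
    then show ?thesis
      using r(1) False by (simp add: M_def field_simps)
  qed
  moreover have "M > 0" using r(1) by (simp add: M_def)
  moreover have "1 / real (Suc n) > 0" by simp
  ultimately show ?thesis by blast
qed

text \<open>The semigroup law splits a time up to \<open>n * d\<close> into steps of length at most
  \<open>d\<close>, each costing one bounded factor. The base \<open>M + 1\<close> exceeds 1, so
  that powers grow with the exponent and a shorter time never needs a larger constant.\<close>

lemma C0_semigroup_locally_bounded:
  fixes T :: "real \<Rightarrow> 'a::banach \<Rightarrow> 'a"
  assumes "C0_semigroup T"
  shows "\<exists>M>0. \<forall>t\<in>{0..\<tau>}. \<forall>x. norm (T t x) \<le> M * norm x"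
proof -
  obtain d M where d: "d > 0" "M > 0" "\<And>t x. t \<in> {0..d} \<Longrightarrow> norm (T t x) \<le> M * norm x"
    using C0_semigroup_bounded_near_0[OF assms] by blast
  have iter: "\<forall>t\<in>{0..real n * d}. \<forall>x. norm (T t x) \<le> (M + 1) ^ Suc n * norm x" for n
  proof (induction n)
    case 0
    show ?case
      using d(3)[of 0] d(1) by (auto simp: algebra_simps add_increasing)
  next
    case (Suc n)
    show ?case
    proof safe
      fix t x assume t: "t \<in> {0..real (Suc n) * d}"
      show "norm (T t x) \<le> (M + 1) ^ Suc (Suc n) * norm x"
      proof (cases "t \<le> d")
        case True
        have "norm (T t x) \<le> (M + 1) ^ 1 * norm x"
          using d(3)[of t x] True t by (simp add: algebra_simps add_increasing)
        also have "\<dots> \<le> (M + 1) ^ Suc (Suc n) * norm x"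
          using d(2) by (intro mult_right_mono power_increasing) auto
        finally show ?thesis .
      next
        case False
        have "T t x = T d (T (t - d) x)"
          using assms False d(1) unfolding C0_semigroup_def
          by (metis add.commute add_diff_cancel_right' diff_add_cancel diff_ge_0_iff_ge less_eq_real_def not_less)
        then have "norm (T t x) \<le> M * norm (T (t - d) x)"
          using d by auto
        also have "\<dots> \<le> (M + 1) * ((M + 1) ^ Suc n * norm x)"
          using Suc t False d(2) by (intro mult_mono) (auto simp: algebra_simps)
        finally show ?thesis by (simp add: mult.assoc)
      qed
    qed
  qed
  obtain n where "\<tau> / d < real n" using reals_Archimedean2 by blast
  then have "\<tau> \<le> real n * d" using d(1) by (simp add: field_simps)
  then have "\<forall>t\<in>{0..\<tau>}. \<forall>x. norm (T t x) \<le> (M + 1) ^ Suc n * norm x"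
    using iter[of n] by auto
  moreover have "(M + 1) ^ Suc n > 0" using d(2) by simp
  ultimately show ?thesis by blast
qed

text \<open>
  Turns nonuniform bounds, valid on each bounded range of radii, into a continuous one:
  a monotone step function is smoothed by integration over \<open>[0, r + 1]\<close>.
\<close>

lemma continuous_majorant:
  fixes Q :: "real \<Rightarrow> real \<Rightarrow> bool"
  assumes ex: "\<And>C. C > 0 \<Longrightarrow> \<exists>m. Q C m"
    and mono: "\<And>C C' m m'. Q C m \<Longrightarrow> C' \<le> C \<Longrightarrow> m \<le> m' \<Longrightarrow> Q C' m'"
  obtains h :: "real \<Rightarrow> real" where "continuous_on {0..} h" "mono_on {0..} h"
    "\<And>r. r \<ge> 0 \<Longrightarrow> h r \<ge> 0" "\<And>r. r \<ge> 0 \<Longrightarrow> Q r (h r)"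
proof -
  obtain m where m: "\<And>n::nat. Q (real (Suc n)) (m n)"
    using ex[of "real (Suc _)"] by (metis of_nat_0_less_iff zero_less_Suc)
  \<comment> \<open>Absolute values make \<open>s\<close> nonnegative and monotone whatever the
    \<open>m k\<close> are. The last summand alone is a valid bound at \<open>r\<close>, since
    \<open>m n\<close> serves all radii up to \<open>n + 1\<close>.\<close>
  define s where "s = (\<lambda>r::real. \<Sum>k\<le>nat \<lceil>r\<rceil>. \<bar>m k\<bar>)"
  have s_nonneg: "s r \<ge> 0" for r
    by (simp add: s_def sum_nonneg)
  have s_mono: "s r \<le> s r'" if "r \<le> r'" for r r'
  proof -
    have "nat \<lceil>r\<rceil> \<le> nat \<lceil>r'\<rceil>"
      using that by (intro nat_mono ceiling_mono)
    then show ?thesis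
      unfolding s_def by (intro sum_mono2) (auto simp del: nat_le_iff nat_le_eq_zle nat_ceiling_le_eq)
  qed
  have s_int: "s integrable_on {a..b}" for a b
    using s_mono by (intro integrable_on_mono_on) (auto simp: mono_on_def)
  have Qs: "Q r (s r)" for r
  proof (rule mono[OF m])
    show "m (nat \<lceil>r\<rceil>) \<le> s r"
      unfolding s_def using member_le_sum[of "nat \<lceil>r\<rceil>" "{..nat \<lceil>r\<rceil>}" "\<lambda>k. \<bar>m k\<bar>"]
      by (simp del: nat_le_iff nat_ceiling_le_eq)
    show "r \<le> real (Suc (nat \<lceil>r\<rceil>))"
      by linarith
  qed
  \<comment> \<open>The integral runs to \<open>r + 1\<close> so that it includes the window
    \<open>{r..r + 1}\<close> of length one, on which \<open>s\<close> is at least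
    \<open>s r\<close>. This gives \<open>s r \<le> h r\<close>.\<close>
  define h where "h = (\<lambda>r. integral {0..r + 1} s)"
  have ge: "s r \<le> h r" if "r \<ge> 0" for r
  proof -
    have "integral {r..r + 1} (\<lambda>_. s r) \<le> integral {r..r + 1} s"
      using s_mono s_int by (intro integral_le) auto
    also have "\<dots> \<le> h r"
      unfolding h_def using s_nonneg s_int that by (intro integral_subset_le) auto
    finally show ?thesis by simp
  qed
  show thesis
  proof (rule that[of h])
    show "continuous_on {0..} h"
      unfolding continuous_on_eq_continuous_within
    proof
      fix r :: real assume r: "r \<in> {0..}"
      have "continuous_on {0..r + 2} (\<lambda>r. integral {0..r} s)"
        by (intro indefinite_integral_continuous_1 s_int)
      then have "continuous_on {0..<r + 1} h"
        unfolding h_def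
        by (rule continuous_on_compose2[of _ _ _ "\<lambda>x. x + 1"]) (auto intro!: continuous_intros)
      then have "continuous (at r within {0..<r + 1}) h"
        using r by (simp add: continuous_on_eq_continuous_within)
      moreover have "at r within {0..<r + 1} = at r within {0..}"
        by (rule at_within_nhd[of _ "{..<r + 1}"]) auto
      ultimately show "continuous (at r within {0..}) h"
        by (metis continuous_within)
    qed
    show "mono_on {0..} h"
      unfolding mono_on_def h_def
      using s_nonneg s_int by (auto intro!: integral_subset_le)
    show "h r \<ge> 0" if "r \<ge> 0" for r
      using ge[OF that] s_nonneg[of r] by linarith
    show "Q r (h r)" if "r \<ge> 0" for r
      using mono[OF Qs _ ge[OF that]] by simp
  qed
qed

text \<open>Turns a majorant \<open>h\<close>, which may be positive at zero or constant, into a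
  comparison function: the factor \<open>r\<close> gives the zero at the origin, and the summand 1
  gives strictness and unboundedness.\<close>

lemma class_K_inf_mult:
  assumes "continuous_on {0..} h" "mono_on {0..} h" "\<And>r. r \<ge> 0 \<Longrightarrow> h r \<ge> (0::real)"
  shows "(\<lambda>r. r * (1 + h r)) \<in> class_K_inf"
proof -
  have "strict_mono_on {0..} (\<lambda>r. r * (1 + h r))"
  proof (rule strict_mono_onI)
    fix r t :: real assume rt: "r \<in> {0..}" "t \<in> {0..}" "r < t"
    then have "r * (1 + h r) \<le> r * (1 + h t)"
      using assms(2) by (intro mult_left_mono) (auto simp: mono_on_def)
    also have "\<dots> < t * (1 + h t)"
      using rt assms(3)[of t] by (intro mult_strict_right_mono) auto
    finally show "r * (1 + h r) < t * (1 + h t)" .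
  qed
  moreover have "\<not> bounded ((\<lambda>r. r * (1 + h r)) ` {0..})"
  proof
    assume "bounded ((\<lambda>r. r * (1 + h r)) ` {0..})"
    then obtain B where B: "\<And>r. r \<ge> 0 \<Longrightarrow> \<bar>r * (1 + h r)\<bar> \<le> B"
      by (auto simp: bounded_iff)
    have "B \<ge> 0" using B[of 0] by simp
    then have "(B + 1) * 1 \<le> (B + 1) * (1 + h (B + 1))"
      using assms(3)[of "B + 1"] by (intro mult_left_mono) auto
    also have "\<dots> \<le> \<bar>(B + 1) * (1 + h (B + 1))\<bar>"
      by simp
    also have "\<dots> \<le> B"
      using B[of "B + 1"] \<open>B \<ge> 0\<close> by simp
    finally show False by simp
  qed
  moreover have "continuous_on {0..} (\<lambda>r. r * (1 + h r))"
    by (intro continuous_intros assms)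
  moreover have "(\<lambda>r. r * (1 + h r)) ` {0..} \<subseteq> {0..}"
    using assms(3) by (intro image_subsetI) (simp add: add_nonneg_nonneg)
  ultimately show ?thesis
    unfolding class_K_inf_def class_K_def by simp
qed

text \<open>Exponential decay is enough for the ISS estimate: the transient will last only up to a
  uniform time \<open>\<tau>\<close>, and a factor \<open>exp \<tau>\<close> in the gain pays for
  the decay until then.\<close>

lemma class_KL_exp:
  assumes "g \<in> class_K"
  shows "(\<lambda>r t. g r * exp (- t)) \<in> class_KL"
proof -
  have g: "\<And>r. r \<ge> 0 \<Longrightarrow> g r \<ge> 0" "continuous_on {0..} g" "strict_mono_on {0..} g" "g 0 = 0"
    using assms by (auto simp: class_K_def)
  have gpos: "g r > 0" if "r > 0" for r
    using g(3)[THEN strict_mono_onD, of 0 r] g(4) that by simp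
  have "continuous_on ({0..} \<times> {0..}) (\<lambda>(r, t). g r * exp (- t))"
    unfolding case_prod_unfold
    by (intro continuous_intros continuous_on_compose2[OF g(2)]) auto
  moreover have "(\<lambda>r. g r * exp (- t)) \<in> class_K" for t
    unfolding class_K_def using g
    by (auto intro!: continuous_intros simp: strict_mono_on_def)
  moreover have "(\<lambda>t. g r * exp (- t)) \<in> class_L" if "r > 0" for r
  proof -
    have "((\<lambda>t. g r * exp (- t)) \<longlongrightarrow> g r * 0) at_top"
      by (intro tendsto_mult tendsto_const filterlim_compose[OF exp_at_bot] filterlim_uminus_at_bot_at_top)
    then show ?thesis
      unfolding class_L_def using gpos[OF that] by (auto intro!: continuous_intros)
  qed
  ultimately show ?thesis
    by (simp add: class_KL_def)
qed

section \<open>Inputs and the cocycle property of the mild flow\<close>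

lemma PC_left_limit:
  assumes "u \<in> PC" "t > 0"
  obtains l where "(u \<longlongrightarrow> l) (at_left t)"
  using assms by (auto simp: PC_def)

lemma PC_right_limit:
  assumes "u \<in> PC" "t \<ge> 0"
  shows "(u \<longlongrightarrow> u t) (at_right t)"
  using assms by (simp add: PC_def continuous_within)

lemma norm_le_input_norm:
  assumes "u \<in> PC" "t \<ge> 0"
  shows "norm (u t) \<le> input_norm u"
proof -
  have "bdd_above ((\<lambda>t. norm (u t)) ` {0..})"
    using assms(1) by (auto simp: PC_def bounded_iff bdd_above_def)
  then show ?thesis
    unfolding input_norm_def using assms(2) by (intro cSUP_upper) auto
qed

lemma input_norm_le:
  assumes "\<And>t. t \<ge> 0 \<Longrightarrow> norm (u t) \<le> B"
  shows "input_norm u \<le> B"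
  unfolding input_norm_def using assms by (intro cSUP_least) auto

lemma input_norm_nonneg: "u \<in> PC \<Longrightarrow> 0 \<le> input_norm u"
  using norm_le_input_norm[of u 0] norm_ge_zero[of "u 0"] by linarith

text \<open>The strict inequality assigns the switching time to \<open>v\<close>, which preserves
  right continuity there.\<close>

definition concat_input :: "real \<Rightarrow> (real \<Rightarrow> 'u) \<Rightarrow> (real \<Rightarrow> 'u) \<Rightarrow> real \<Rightarrow> 'u" where
  "concat_input t0 u v = (\<lambda>t. if t < t0 then u t else v (t - t0))"

text \<open>The strict inequality puts \<open>t - c\<close> in the interior of the half-line, where
  continuity within the half-line is ordinary continuity. A negative \<open>c\<close> is allowed,
  and \<open>PC_shift\<close> uses one.\<close>

lemma continuous_at_shift:
  fixes v :: "real \<Rightarrow> 'u::topological_space"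
  assumes "continuous (at (t - c) within {0..}) v" "t > c"
  shows "continuous (at t) (\<lambda>t. v (t - c))"
proof -
  have "at (t - c) within {0..} = at (t - c)"
    using assms(2) by (intro at_within_interior) auto
  then show ?thesis
    using assms(1) by (intro isCont_o2[of t "\<lambda>t. t - c" v]) simp_all
qed

text \<open>New discontinuities can arise only at \<open>t0\<close>; the others come from
  \<open>u\<close> before it or are translates of those of \<open>v\<close>. Each one-sided limit
  involves a single piece: at \<open>t0\<close> the left one comes from \<open>u\<close> and the
  right one from \<open>v\<close>.\<close>

lemma PC_concat:
  fixes u v :: "real \<Rightarrow> 'u::real_normed_vector"
  assumes u: "u \<in> PC" and v: "v \<in> PC" and t0: "t0 \<ge> 0"
  shows "concat_input t0 u v \<in> PC"
proof -
  let ?w = "concat_input t0 u v"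
  have "?w ` {0..} \<subseteq> u ` {0..} \<union> v ` {0..}"
    by (auto simp: concat_input_def)
  moreover have "bounded (u ` {0..} \<union> v ` {0..})"
    using u v by (simp add: PC_def)
  ultimately have "bounded (?w ` {0..})"
    using bounded_subset by blast
  moreover have "finite {t\<in>{0..b}. \<not> continuous (at t within {0..}) ?w}" for b
  proof (rule finite_subset)
    let ?D = "\<lambda>b u. {t\<in>{0..b}. \<not> continuous (at t within {0..}) u}"
    show "finite (?D t0 u \<union> {t0} \<union> (\<lambda>t. t - t0) -` ?D (b - t0) v)"
      using u v by (intro finite_UnI finite_vimageI) (simp_all add: PC_def inj_on_def)
    have "t = t0 \<or> t \<in> ?D t0 u \<or> t - t0 \<in> ?D (b - t0) v" if t: "t \<in> ?D b ?w" for t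
    proof (cases t t0 rule: linorder_cases)
      case less
      have "\<not> continuous (at t within {0..}) u"
      proof
        assume "continuous (at t within {0..}) u"
        then have "continuous (at t within {0..}) ?w"
          by (rule continuous_transform_within[where \<delta> = "t0 - t"])
            (use t less in \<open>auto simp: concat_input_def dist_real_def\<close>)
        then show False using t by simp
      qed
      then show ?thesis using t less by simp
    next
      case greater
      have "\<not> continuous (at (t - t0) within {0..}) v"
      proof
        assume "continuous (at (t - t0) within {0..}) v"
        then have "continuous (at t within {0..}) (\<lambda>t. v (t - t0))"
          using greater by (intro continuous_at_imp_continuous_within[OF continuous_at_shift[of t t0 v]])
        then have "continuous (at t within {0..}) ?w"
          by (rule continuous_transform_within[where \<delta> = "t - t0"])
            (use t greater in \<open>auto simp: concat_input_def dist_real_def\<close>)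
        then show False using t by simp
      qed
      then show ?thesis using t greater by simp
    qed simp
    then show "?D b ?w \<subseteq> ?D t0 u \<union> {t0} \<union> (\<lambda>t. t - t0) -` ?D (b - t0) v"
      unfolding subset_iff Un_iff vimage_eq singleton_iff by blast
  qed
  moreover have "\<exists>l. (?w \<longlongrightarrow> l) (at_left t)" if t: "t > 0" for t
  proof (cases "t \<le> t0")
    case True
    have "\<forall>\<^sub>F s in at_left t. u s = ?w s"
      unfolding eventually_at_left_field using True by (auto simp: concat_input_def intro!: exI[of _ "t - 1"])
    moreover obtain l where "(u \<longlongrightarrow> l) (at_left t)"
      using PC_left_limit[OF u t] .
    ultimately show ?thesis
      by (auto intro: Lim_transform_eventually)
  next
    case False
    have "\<forall>\<^sub>F s in at_left t. v (s - t0) = ?w s"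
      unfolding eventually_at_left_field using False by (auto simp: concat_input_def intro!: exI[of _ t0])
    moreover obtain l where "(v \<longlongrightarrow> l) (at_left (t - t0))"
      using PC_left_limit[OF v, of "t - t0"] False by auto
    then have "((\<lambda>s. v (s - t0)) \<longlongrightarrow> l) (at_left t)"
      by (simp add: filterlim_filtermap flip: filtermap_at_left_shift)
    ultimately show ?thesis
      by (auto intro: Lim_transform_eventually)
  qed
  moreover have "continuous (at_right t) ?w" if "t \<ge> 0" for t
  proof (cases "t < t0")
    case True
    have "\<forall>\<^sub>F s in at_right t. u s = ?w s"
      unfolding eventually_at_right_field using True by (auto simp: concat_input_def intro!: exI[of _ t0])
    moreover have "(u \<longlongrightarrow> u t) (at_right t)"
      using PC_right_limit[OF u that] .
    ultimately have "(?w \<longlongrightarrow> u t) (at_right t)"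
      by (auto intro: Lim_transform_eventually)
    then show ?thesis
      using True by (simp add: continuous_within concat_input_def)
  next
    case False
    have "\<forall>\<^sub>F s in at_right t. v (s - t0) = ?w s"
      unfolding eventually_at_right_field using False by (auto simp: concat_input_def intro!: exI[of _ "t + 1"])
    moreover have "(v \<longlongrightarrow> v (t - t0)) (at_right (t - t0))"
      using PC_right_limit[OF v] False by simp
    then have "((\<lambda>s. v (s - t0)) \<longlongrightarrow> v (t - t0)) (at_right t)"
      by (simp add: filterlim_filtermap flip: filtermap_at_right_shift)
    ultimately have "(?w \<longlongrightarrow> v (t - t0)) (at_right t)"
      by (auto intro: Lim_transform_eventually)
    then show ?thesis
      using False by (simp add: continuous_within concat_input_def)
  qed
  ultimately show ?thesis
    by (simp add: PC_def)
qed

lemma PC_shift: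
  fixes u :: "real \<Rightarrow> 'u::real_normed_vector"
  assumes u: "u \<in> PC" and c: "c \<ge> 0"
  shows "(\<lambda>t. u (t + c)) \<in> PC"
proof -
  let ?w = "\<lambda>t. u (t + c)"
  have "?w ` {0..} \<subseteq> u ` {0..}"
    using c by auto
  moreover have "bounded (u ` {0..})"
    using u by (simp add: PC_def)
  ultimately have "bounded (?w ` {0..})"
    using bounded_subset by blast
  moreover have "finite {t\<in>{0..b}. \<not> continuous (at t within {0..}) ?w}" for b
  proof (rule finite_subset)
    let ?D = "\<lambda>b u. {t\<in>{0..b}. \<not> continuous (at t within {0..}) u}"
    \<comment> \<open>Time \<open>0\<close> is excepted because for \<open>c = 0\<close> it is no
      interior point, so \<open>continuous_at_shift\<close> does not reach it; one more point keeps
      the set finite.\<close>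
    show "finite ({0} \<union> (\<lambda>t. t + c) -` ?D (b + c) u)"
      using u by (intro finite_UnI finite_vimageI) (simp_all add: PC_def inj_on_def)
    have "t = 0 \<or> t + c \<in> ?D (b + c) u" if t: "t \<in> ?D b ?w" for t
    proof (cases "t = 0")
      case False
      have "\<not> continuous (at (t + c) within {0..}) u"
      proof
        assume "continuous (at (t + c) within {0..}) u"
        then have "continuous (at t) (\<lambda>t. u (t - (- c)))"
          using t False c continuous_at_shift[of t "- c" u] by simp
        then show False
          using t continuous_at_imp_continuous_within[of t ?w] by simp
      qed
      then show ?thesis using t c by simp
    qed simp
    then show "?D b ?w \<subseteq> {0} \<union> (\<lambda>t. t + c) -` ?D (b + c) u"
      unfolding subset_iff Un_iff vimage_eq singleton_iff by blast
  qed
  moreover have "\<exists>l. (?w \<longlongrightarrow> l) (at_left t)" if t: "t > 0" for t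
  proof -
    obtain l where "(u \<longlongrightarrow> l) (at_left (t - (- c)))"
      using PC_left_limit[OF u, of "t - (- c)"] t c by auto
    then have "((\<lambda>s. u (s - (- c))) \<longlongrightarrow> l) (at_left t)"
      unfolding filtermap_at_left_shift[symmetric] filterlim_filtermap .
    then show ?thesis by auto
  qed
  moreover have "continuous (at_right t) ?w" if "t \<ge> 0" for t
  proof -
    have "(u \<longlongrightarrow> u (t + c)) (at_right (t - (- c)))"
      using PC_right_limit[OF u, of "t + c"] that c by simp
    then have "((\<lambda>s. u (s - (- c))) \<longlongrightarrow> u (t + c)) (at_right t)"
      unfolding filtermap_at_right_shift[symmetric] filterlim_filtermap .
    then show ?thesis
      by (simp add: continuous_within)
  qed
  ultimately show ?thesis
    by (simp add: PC_def)
qed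

lemma concat_input_shift: "concat_input t0 u (\<lambda>t. u (t + t0)) = u"
  by (auto simp: concat_input_def)

lemma input_norm_concat:
  assumes "u \<in> PC" "v \<in> PC" "t0 \<ge> 0" "input_norm u \<le> B" "input_norm v \<le> B"
  shows "input_norm (concat_input t0 u v) \<le> B"
proof (rule input_norm_le)
  fix t :: real assume "t \<ge> 0"
  then show "norm (concat_input t0 u v t) \<le> B"
    using assms norm_le_input_norm[of u t] norm_le_input_norm[of v "t - t0"]
    by (auto simp: concat_input_def)
qed

lemma input_norm_shift:
  assumes "u \<in> PC" "c \<ge> 0"
  shows "input_norm (\<lambda>t. u (t + c)) \<le> input_norm u"
  by (rule input_norm_le, rule norm_le_input_norm) (use assms in auto)

section \<open>Mild solutions: gluing, the cocycle law, Lipschitz dependence on the initial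
  state\<close>

lemma global_mild_solutionD:
  assumes "global_mild_solution T f x u \<xi>"
  shows "\<xi> 0 = x" "continuous_on {0..\<tau>} \<xi>"
    and "t \<ge> 0 \<Longrightarrow> ((\<lambda>s. T (t - s) (f (\<xi> s) (u s))) has_integral \<xi> t - T t x) {0..t}"
proof -
  show x: "\<xi> 0 = x"
    using assms by (simp add: global_mild_solution_def)
  \<comment> \<open>The definition speaks of positive horizons only; the maximum with 1 supplies one
    for every \<open>\<tau>\<close>.\<close>
  have sol: "mild_solution_on T f u (max \<tau> 1) \<xi>" for \<tau>
    using assms by (simp add: global_mild_solution_def)
  show "continuous_on {0..\<tau>} \<xi>"
    using sol[of \<tau>] unfolding mild_solution_on_def
    by (rule continuous_on_subset[OF conjunct1]) auto
  assume "t \<ge> 0"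
  then have "(\<lambda>s. T (t - s) (f (\<xi> s) (u s))) integrable_on {0..t}"
    and "\<xi> t = T t x + integral {0..t} (\<lambda>s. T (t - s) (f (\<xi> s) (u s)))"
    using sol[of t] x by (auto simp: mild_solution_on_def)
  then show "((\<lambda>s. T (t - s) (f (\<xi> s) (u s))) has_integral \<xi> t - T t x) {0..t}"
    by (metis add_diff_cancel_left' integrable_integral)
qed

lemma global_mild_solutionI:
  assumes "\<xi> 0 = x" "\<And>\<tau>. continuous_on {0..\<tau>} \<xi>"
    and int: "\<And>t. t \<ge> 0 \<Longrightarrow> ((\<lambda>s. T (t - s) (f (\<xi> s) (u s))) has_integral \<xi> t - T t x) {0..t}"
  shows "global_mild_solution T f x u \<xi>"
  unfolding global_mild_solution_def mild_solution_on_def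
proof safe
  fix t \<tau> :: real assume "t \<in> {0..\<tau>}"
  then have "((\<lambda>s. T (t - s) (f (\<xi> s) (u s))) has_integral \<xi> t - T t x) {0..t}"
    by (intro int) simp
  then show "(\<lambda>s. T (t - s) (f (\<xi> s) (u s))) integrable_on {0..t}"
    and "\<xi> t = T t (\<xi> 0) + integral {0..t} (\<lambda>s. T (t - s) (f (\<xi> s) (u s)))"
    using assms(1) by (auto simp: integral_unique)
qed (use assms in auto)

text \<open>Beyond \<open>t0\<close>, split the integral there. Applying \<open>T (t - t0)\<close>
  to the integral equation for \<open>\<xi>\<close> at \<open>t0\<close> gives the first part by the
  semigroup law, and translating the equation for \<open>\<eta>\<close> gives the second. The terms
  \<open>T (t - t0) (\<xi> t0)\<close> cancel in the sum.\<close>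

lemma global_mild_solution_concat:
  fixes T :: "real \<Rightarrow> 'a::banach \<Rightarrow> 'a"
  assumes T: "C0_semigroup T" and t0: "t0 \<ge> 0"
    and \<xi>: "global_mild_solution T f x u \<xi>"
    and \<eta>: "global_mild_solution T f (\<xi> t0) v \<eta>"
  shows "global_mild_solution T f x (concat_input t0 u v) (\<lambda>t. if t \<le> t0 then \<xi> t else \<eta> (t - t0))"
    (is "global_mild_solution T f x ?w ?\<zeta>")
proof (rule global_mild_solutionI)
  note \<xi>' = global_mild_solutionD[OF \<xi>] and \<eta>' = global_mild_solutionD[OF \<eta>]
  show "?\<zeta> 0 = x"
    using t0 \<xi>'(1) by simp
  show "continuous_on {0..\<tau>} ?\<zeta>" for \<tau>
  proof (rule continuous_on_cases_le)
    show "continuous_on {t \<in> {0..\<tau>}. t \<le> t0} \<xi>"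
      by (rule continuous_on_subset[OF \<xi>'(2)[of \<tau>]]) auto
    show "continuous_on {t \<in> {0..\<tau>}. t0 \<le> t} (\<lambda>t. \<eta> (t - t0))"
      by (rule continuous_on_compose2[OF \<eta>'(2)[of "\<tau> - t0"]]) (auto intro!: continuous_intros)
  qed (use \<eta>'(1) in auto)
  fix t :: real assume t: "t \<ge> 0"
  show "((\<lambda>s. T (t - s) (f (?\<zeta> s) (?w s))) has_integral ?\<zeta> t - T t x) {0..t}"
  proof (cases "t \<le> t0")
    case True
    \<comment> \<open>At \<open>s = t0\<close> the concatenated input already takes its value from
      \<open>v\<close>; a single point does not change the integral.\<close>
    have "((\<lambda>s. T (t - s) (f (?\<zeta> s) (?w s))) has_integral \<xi> t - T t x) {0..t}"
      using True
      by (intro has_integral_spike_finite[of "{t0}", OF _ _ \<xi>'(3)[OF t]]) (auto simp: concat_input_def)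
    then show ?thesis using True by simp
  next
    case False
    have lin: "bounded_linear (T (t - t0))"
      using T False by (simp add: C0_semigroup_def)
    have semi: "T (t - t0) (T (t0 - s) y) = T (t - s) y" if "s \<le> t0" for s y
    proof -
      have "\<forall>s\<ge>0. \<forall>t\<ge>0. \<forall>x. T (s + t) x = T s (T t x)"
        using T by (simp add: C0_semigroup_def)
      then have "T (t - t0 + (t0 - s)) y = T (t - t0) (T (t0 - s) y)"
        using False that by (meson diff_ge_0_iff_ge linorder_le_cases)
      then show ?thesis by simp
    qed
    have "((\<lambda>s. T (t - t0) (T (t0 - s) (f (\<xi> s) (u s)))) has_integral
        T (t - t0) (\<xi> t0 - T t0 x)) {0..t0}"
      using has_integral_linear[OF \<xi>'(3)[OF t0] lin] by (simp add: o_def)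
    moreover have "T (t - t0) (\<xi> t0 - T t0 x) = T (t - t0) (\<xi> t0) - T t x"
      using semi[of 0] t0 lin by (simp add: linear_diff bounded_linear.linear)
    ultimately have "((\<lambda>s. T (t - s) (f (?\<zeta> s) (?w s))) has_integral
        T (t - t0) (\<xi> t0) - T t x) {0..t0}"
      by (rule_tac has_integral_spike_finite[of "{t0}" "{0..t0}" _
            "\<lambda>s. T (t - t0) (T (t0 - s) (f (\<xi> s) (u s)))"])
        (simp_all add: concat_input_def semi)
    moreover have "((\<lambda>s. T (t - s) (f (?\<zeta> s) (?w s))) has_integral
        \<eta> (t - t0) - T (t - t0) (\<xi> t0)) {t0..t}"
    proof (rule has_integral_spike_finite[of "{t0}"])
      show "((\<lambda>s. T (t - t0 - (s + - t0)) (f (\<eta> (s + - t0)) (v (s + - t0)))) has_integral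
          \<eta> (t - t0) - T (t - t0) (\<xi> t0)) {t0..t}"
        using has_integral_shift_real_ivl[OF \<eta>'(3)[of "t - t0"], of "- t0"] False by simp
    qed (auto simp: concat_input_def)
    ultimately have "((\<lambda>s. T (t - s) (f (?\<zeta> s) (?w s))) has_integral
        (T (t - t0) (\<xi> t0) - T t x) + (\<eta> (t - t0) - T (t - t0) (\<xi> t0))) {0..t}"
      using False t0 by (intro has_integral_combine[of 0 t0]) auto
    then show ?thesis
      using False by simp
  qed
qed

lemma mild_flow_eq:
  assumes "unique_global_solutions T f" "u \<in> PC" "global_mild_solution T f x u \<xi>" "t \<ge> 0"
  shows "mild_flow T f t x u = \<xi> t"
  unfolding mild_flow_def
  using assms by (intro the_equality) (auto simp: unique_global_solutions_def)

lemma global_mild_solution_mild_flow: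
  assumes "unique_global_solutions T f" "u \<in> PC"
  obtains \<xi> where "global_mild_solution T f x u \<xi>" "\<And>t. t \<ge> 0 \<Longrightarrow> mild_flow T f t x u = \<xi> t"
proof -
  obtain \<xi> where "global_mild_solution T f x u \<xi>"
    using assms unfolding unique_global_solutions_def by blast
  then show thesis
    using that[of \<xi>] mild_flow_eq[OF assms] by blast
qed

lemma mild_flow_concat:
  fixes T :: "real \<Rightarrow> 'a::banach \<Rightarrow> 'a"
  assumes T: "C0_semigroup T" "unique_global_solutions T f"
    and uv: "u \<in> PC" "v \<in> PC" and t: "s \<ge> 0" "t \<ge> 0"
  shows "mild_flow T f (s + t) x (concat_input s u v) = mild_flow T f t (mild_flow T f s x u) v"
proof -
  obtain \<xi> where \<xi>: "global_mild_solution T f x u \<xi>" "mild_flow T f s x u = \<xi> s"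
    using global_mild_solution_mild_flow[OF T(2) uv(1)] t(1) by metis
  obtain \<eta> where \<eta>: "global_mild_solution T f (\<xi> s) v \<eta>" "mild_flow T f t (\<xi> s) v = \<eta> t"
    using global_mild_solution_mild_flow[OF T(2) uv(2)] t(2) by metis
  \<comment> \<open>Needed for \<open>t = 0\<close>, where the glued solution is still evaluated by
    its first branch.\<close>
  have "\<eta> 0 = \<xi> s"
    using \<eta>(1) by (rule global_mild_solutionD)
  then have "mild_flow T f (s + t) x (concat_input s u v) = \<eta> t"
    using t PC_concat[OF uv t(1)]
    by (subst mild_flow_eq[OF T(2) _ global_mild_solution_concat[OF T(1) t(1) \<xi>(1) \<eta>(1)]]) auto
  then show ?thesis
    using \<xi>(2) \<eta>(2) by simp
qed

lemma BRS_bound: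
  assumes "BRS \<phi>" "C > 0" "\<tau> > 0"
  obtains B where "\<And>t x u. norm x \<le> C \<Longrightarrow> u \<in> PC \<Longrightarrow> input_norm u \<le> C \<Longrightarrow> t \<in> {0..\<tau>} \<Longrightarrow>
    norm (\<phi> t x u) \<le> B"
proof -
  let ?S = "{norm (\<phi> t x u) | t x u. norm x \<le> C \<and> u \<in> PC \<and> input_norm u \<le> C \<and> t \<in> {0..\<tau>}}"
  have bdd: "bdd_above ?S"
    using assms unfolding BRS_def by simp
  show thesis
    by (rule that[of "Sup ?S"], rule cSup_upper[OF _ bdd]) blast
qed

text \<open>BRS confines both trajectories to one ball, on which \<open>f\<close> has a Lipschitz
  constant \<open>K\<close>. Subtracting the two integral equations and bounding the semigroup by
  \<open>M\<close> on \<open>{0..\<tau>}\<close> leaves an integral inequality for the norm of the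
  difference, to which \<open>gronwall\<close> applies.\<close>

lemma mild_flow_lipschitz:
  fixes T :: "real \<Rightarrow> 'a::banach \<Rightarrow> 'a"
  assumes T: "C0_semigroup T" "lipschitz_on_bounded f" "unique_global_solutions T f"
    and BRS: "BRS (mild_flow T f)" and C: "C > 0" "\<tau> > 0"
  shows "\<exists>L\<ge>0. \<forall>x y. \<forall>u\<in>PC. \<forall>t\<in>{0..\<tau>}. norm x \<le> C \<longrightarrow> norm y \<le> C \<longrightarrow> input_norm u \<le> C \<longrightarrow>
    norm (mild_flow T f t x u - mild_flow T f t y u) \<le> L * norm (x - y)"
proof -
  obtain B where B: "\<And>t x u. norm x \<le> C \<Longrightarrow> u \<in> PC \<Longrightarrow> input_norm u \<le> C \<Longrightarrow> t \<in> {0..\<tau>} \<Longrightarrow>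
      norm (mild_flow T f t x u) \<le> B"
    using BRS_bound[OF BRS C] by blast
  \<comment> \<open>One constant must bound the states (by \<open>B\<close>) and the input values
    (by \<open>C\<close>), and it must be positive.\<close>
  have "max B C > 0"
    using C(1) by simp
  obtain K where K: "K > 0" "\<And>x y v. norm x \<le> max B C \<Longrightarrow> norm y \<le> max B C \<Longrightarrow> norm v \<le> max B C \<Longrightarrow>
      norm (f x v - f y v) \<le> K * norm (x - y)"
    using T(2)[unfolded lipschitz_on_bounded_def, rule_format, OF \<open>max B C > 0\<close>] by blast
  obtain M where M: "M > 0" "\<And>t x. t \<in> {0..\<tau>} \<Longrightarrow> norm (T t x) \<le> M * norm x"
    using C0_semigroup_locally_bounded[OF T(1)] by blast
  have lin: "T t (x - y) = T t x - T t y" if "t \<ge> 0" for t x y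
    using T(1) that by (simp add: C0_semigroup_def linear_diff bounded_linear.linear)
  have "norm (mild_flow T f t x u - mild_flow T f t y u) \<le> M * exp (M * K * \<tau>) * norm (x - y)"
    if xyu: "norm x \<le> C" "norm y \<le> C" "u \<in> PC" "input_norm u \<le> C" and t: "t \<in> {0..\<tau>}" for x y u t
  proof -
    obtain \<xi> where \<xi>: "global_mild_solution T f x u \<xi>" "\<And>t. t \<ge> 0 \<Longrightarrow> mild_flow T f t x u = \<xi> t"
      using global_mild_solution_mild_flow[OF T(3) xyu(3)] by metis
    obtain \<eta> where \<eta>: "global_mild_solution T f y u \<eta>" "\<And>t. t \<ge> 0 \<Longrightarrow> mild_flow T f t y u = \<eta> t"
      using global_mild_solution_mild_flow[OF T(3) xyu(3)] by metis
    note \<xi>' = global_mild_solutionD[OF \<xi>(1)] and \<eta>' = global_mild_solutionD[OF \<eta>(1)]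
    define e where "e = (\<lambda>t. norm (\<xi> t - \<eta> t))"
    have e: "continuous_on {0..\<tau>} e"
      unfolding e_def by (intro continuous_intros \<xi>' \<eta>')
    have f_le: "norm (f (\<xi> s) (u s) - f (\<eta> s) (u s)) \<le> K * e s" if "s \<in> {0..\<tau>}" for s
    proof -
      have "norm (\<xi> s) \<le> B" "norm (\<eta> s) \<le> B" "norm (u s) \<le> C"
        using B[OF xyu(1,3,4) that] B[OF xyu(2,3,4) that] \<xi>(2) \<eta>(2) that
          norm_le_input_norm[OF xyu(3), of s] xyu(4) by auto
      then show ?thesis
        unfolding e_def by (intro K) auto
    qed
    have "e t \<le> M * norm (x - y) * exp (M * K * t)"
    proof (rule gronwall[OF e _ _ t])
      fix t assume t: "t \<in> {0..\<tau>}"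
      let ?g = "\<lambda>s. T (t - s) (f (\<xi> s) (u s)) - T (t - s) (f (\<eta> s) (u s))"
      have g: "(?g has_integral (\<xi> t - T t x) - (\<eta> t - T t y)) {0..t}"
        using \<xi>'(3)[of t] \<eta>'(3)[of t] t by (intro has_integral_diff) auto
      have "norm (integral {0..t} ?g) \<le> integral {0..t} (\<lambda>s. M * K * e s)"
      proof (rule integral_norm_bound_integral)
        show "?g integrable_on {0..t}"
          using g by blast
        show "(\<lambda>s. M * K * e s) integrable_on {0..t}"
          using t by (intro integrable_continuous_interval continuous_intros continuous_on_subset[OF e]) auto
        fix s assume s: "s \<in> {0..t}"
        have "norm (?g s) = norm (T (t - s) (f (\<xi> s) (u s) - f (\<eta> s) (u s)))"
          using s by (simp add: lin)
        also have "\<dots> \<le> M * norm (f (\<xi> s) (u s) - f (\<eta> s) (u s))"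
          using s t by (intro M) auto
        also have "\<dots> \<le> M * (K * e s)"
          using s t M(1) by (intro mult_left_mono f_le) auto
        finally show "norm (?g s) \<le> M * K * e s"
          by (simp add: mult.assoc)
      qed
      moreover have "\<xi> t - \<eta> t = T t (x - y) + integral {0..t} ?g"
        using integral_unique[OF g] t by (simp add: lin)
      moreover have "norm (T t (x - y)) \<le> M * norm (x - y)"
        using t by (rule M)
      ultimately show "e t \<le> M * norm (x - y) + M * K * integral {0..t} e"
        unfolding e_def using norm_triangle_ineq[of "T t (x - y)" "integral {0..t} ?g"] by simp
    qed (use M K in simp)
    also have "\<dots> \<le> M * norm (x - y) * exp (M * K * \<tau>)"
      using t M(1) K(1) by (intro mult_left_mono) auto
    finally show ?thesis
      using t \<xi>(2) \<eta>(2) by (simp add: e_def mult_ac)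
  qed
  moreover have "M * exp (M * K * \<tau>) \<ge> 0"
    using M(1) by simp
  ultimately show ?thesis by blast
qed

section \<open>Stability of abstract control systems\<close>

lemma infdist_le_norm:
  assumes "\<And>y. y \<in> S \<Longrightarrow> norm y \<le> K" "S \<noteq> {}"
  shows "infdist x S \<le> norm x + K"
proof -
  obtain a where "a \<in> S" using assms(2) by blast
  then have "infdist x S \<le> dist x a" "norm a \<le> K"
    using assms(1) by (auto intro: infdist_le)
  then show ?thesis
    using norm_triangle_ineq4[of x a] by (simp add: dist_norm)
qed

lemma infdist_geI:
  assumes "S \<noteq> {}" "\<And>y. y \<in> S \<Longrightarrow> z \<le> dist x y"
  shows "z \<le> infdist x S"
  using assms by (simp add: infdist_notempty cINF_greatest)

text \<open>Together with \<open>infdist_le_norm\<close> this exchanges distance to a bounded set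
  and norm at the cost of \<open>K\<close>, which allows passing from one reference set to
  another.\<close>

lemma norm_le_infdist:
  assumes "\<And>y. y \<in> S \<Longrightarrow> norm y \<le> K" "S \<noteq> {}"
  shows "norm x \<le> infdist x S + K"
proof -
  have "norm x - K \<le> infdist x S"
  proof (rule infdist_geI[OF assms(2)])
    show "norm x - K \<le> dist x y" if "y \<in> S" for y
      using norm_triangle_ineq2[of x y] assms(1)[OF that] by (simp add: dist_norm)
  qed
  then show ?thesis by simp
qed

text \<open>Outside the ball, the radial projection of \<open>z\<close> is a point of the ball at
  distance \<open>norm z - R\<close>.\<close>

lemma infdist_cball_le:
  fixes z :: "'a::real_normed_vector"
  assumes "R \<ge> 0"
  shows "infdist z (cball 0 R) \<le> max 0 (norm z - R)"
proof (cases "norm z \<le> R")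
  case True
  then show ?thesis by simp
next
  case False
  then have z: "norm z > R" "norm z > 0" using assms by auto
  have "dist z ((R / norm z) *\<^sub>R z) = norm ((1 - R / norm z) *\<^sub>R z)"
    by (simp add: dist_norm algebra_simps)
  also have "\<dots> = norm z - R"
    using z by (simp add: field_simps)
  finally have "dist z ((R / norm z) *\<^sub>R z) = norm z - R" .
  moreover have "(R / norm z) *\<^sub>R z \<in> cball 0 R"
    using z assms by simp
  ultimately show ?thesis
    by (metis infdist_le max.coboundedI2)
qed

lemma class_K_mono: "\<gamma> \<in> class_K \<Longrightarrow> 0 \<le> p \<Longrightarrow> p \<le> q \<Longrightarrow> \<gamma> p \<le> \<gamma> q"
  using strict_mono_on_leD[of "{0..}" \<gamma> p q] by (simp add: class_K_def)

lemma class_K_nonneg: "\<gamma> \<in> class_K \<Longrightarrow> 0 \<le> p \<Longrightarrow> 0 \<le> \<gamma> p"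
  unfolding class_K_def by auto

section \<open>From ISpS to ULIM, and from ULIM to recurrence\<close>

lemma ISpS_imp_ULIM:
  assumes "ISpS \<phi>"
  shows "\<exists>S. bounded S \<and> S \<noteq> {} \<and> ULIM_wrt \<phi> S"
proof -
  obtain A \<beta> \<gamma> c where A: "bounded A" "A \<noteq> {}"
    and \<beta>: "\<beta> \<in> class_KL" and \<gamma>: "\<gamma> \<in> class_K_inf" and "c > 0"
    and est: "\<And>x u t. u \<in> PC \<Longrightarrow> t \<ge> 0 \<Longrightarrow>
      infdist (\<phi> t x u) A \<le> \<beta> (infdist x A) t + \<gamma> (input_norm u) + c"
    using assms unfolding ISpS_def ISpS_wrt_def by (elim exE conjE bexE) blast
  obtain K where K: "K > 0" "\<And>y. y \<in> A \<Longrightarrow> norm y \<le> K"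
    using A(1) unfolding bounded_pos by blast
  \<comment> \<open>In the radius, \<open>c\<close> swallows the ISpS offset and \<open>K\<close>
    the passage from distance to \<open>A\<close> to norm.\<close>
  define S where "S = cball (0::'a) (c + K)"
  have S: "norm y \<le> c + K" if "y \<in> S" for y
    using that by (simp add: S_def)
  have Sne: "S \<noteq> {}"
    using K(1) \<open>c > 0\<close> by (simp add: S_def)
  have "\<exists>\<tau>. \<forall>u\<in>PC. \<forall>x. infdist x S \<le> r \<longrightarrow>
      (\<exists>t\<in>{0..\<tau>}. infdist (\<phi> t x u) S \<le> \<epsilon> + \<gamma> (input_norm u))" if "\<epsilon> > 0" "r > 0" for \<epsilon> r
  proof -
    \<comment> \<open>Distance at most \<open>r\<close> to \<open>S\<close> means norm at most
      \<open>r + c + K\<close>, hence distance at most \<open>r + c + 2 * K\<close> to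
      \<open>A\<close>. Since \<open>\<beta>\<close> is monotone in its first argument, one time
      \<open>\<tau>\<close> with \<open>\<beta> r' \<tau> < \<epsilon>\<close> serves all these
      states.\<close>
    define r' where "r' = r + c + 2 * K"
    have "r' > 0" using that K(1) \<open>c > 0\<close> by (simp add: r'_def)
    then have "(\<beta> r' \<longlongrightarrow> 0) at_top"
      using \<beta> by (simp add: class_KL_def class_L_def)
    then have "\<forall>\<^sub>F t in at_top. \<beta> r' t < \<epsilon> \<and> t \<ge> 0"
      using that(1) by (intro eventually_conj order_tendstoD eventually_ge_at_top)
    then obtain \<tau> where \<tau>: "\<beta> r' \<tau> < \<epsilon>" "\<tau> \<ge> 0"
      by (auto simp: eventually_at_top_linorder)
    have "infdist (\<phi> \<tau> x u) S \<le> \<epsilon> + \<gamma> (input_norm u)" if u: "u \<in> PC" and x: "infdist x S \<le> r" for x u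
    proof -
      have "norm x \<le> r + (c + K)"
        using norm_le_infdist[OF S Sne, of x] x by simp
      then have "infdist x A \<le> r'"
        using infdist_le_norm[OF K(2) A(2), of x] by (simp add: r'_def)
      moreover have "(\<lambda>r. \<beta> r \<tau>) \<in> class_K"
        using \<beta> \<tau>(2) by (simp add: class_KL_def)
      ultimately have "\<beta> (infdist x A) \<tau> \<le> \<epsilon>"
        using class_K_mono[of "\<lambda>r. \<beta> r \<tau>"] infdist_nonneg[of x A] \<tau>(1) by force
      then have "norm (\<phi> \<tau> x u) - (c + K) \<le> \<epsilon> + \<gamma> (input_norm u)"
        using norm_le_infdist[OF K(2) A(2), of "\<phi> \<tau> x u"] est[OF u \<tau>(2), of x] by simp
      moreover have "0 \<le> \<epsilon> + \<gamma> (input_norm u)"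
        using class_K_nonneg[of \<gamma>] \<gamma> input_norm_nonneg[OF u] \<open>\<epsilon> > 0\<close> by (simp add: class_K_inf_def)
      ultimately show ?thesis
        using infdist_cball_le[of "c + K" "\<phi> \<tau> x u"] K(1) \<open>c > 0\<close> by (simp add: S_def)
    qed
    moreover have "\<tau> \<in> {0..\<tau>}"
      using \<tau>(2) by simp
    ultimately show ?thesis by blast
  qed
  then have "ULIM_wrt \<phi> S"
    unfolding ULIM_wrt_def using \<gamma> by blast
  then show ?thesis
    using Sne by (auto simp: S_def)
qed

text \<open>A coarse form of ULIM: the tolerance \<open>\<epsilon>\<close> is frozen and becomes
  part of \<open>\<rho>\<close>, and norms replace distances. Accordingly \<open>\<rho> 0\<close>
  may be positive.\<close>

definition recurrent :: "(real \<Rightarrow> 'a::real_normed_vector \<Rightarrow> (real \<Rightarrow> 'u::real_normed_vector) \<Rightarrow> 'a) \<Rightarrow>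
    (real \<Rightarrow> real) \<Rightarrow> bool" where
  "recurrent \<phi> \<rho> \<longleftrightarrow> (\<forall>r>0. \<exists>\<tau>. \<forall>u\<in>PC. \<forall>x. norm x \<le> r \<longrightarrow>
     (\<exists>t\<in>{0..\<tau>}. norm (\<phi> t x u) \<le> \<rho> (input_norm u)))"

lemma ULIM_imp_recurrent:
  assumes "ULIM_wrt \<phi> S" "bounded S" "S \<noteq> {}"
  obtains \<rho> where "recurrent \<phi> \<rho>" "mono_on {0..} \<rho>" "\<And>p. p \<ge> 0 \<Longrightarrow> \<rho> p \<ge> 0"
proof -
  obtain \<gamma> where \<gamma>: "\<gamma> \<in> class_K_inf"
    and lim: "\<And>r. r > 0 \<Longrightarrow> \<exists>\<tau>. \<forall>u\<in>PC. \<forall>x. infdist x S \<le> r \<longrightarrow>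
      (\<exists>t\<in>{0..\<tau>}. infdist (\<phi> t x u) S \<le> 1 + \<gamma> (input_norm u))"
    using assms(1) zero_less_one unfolding ULIM_wrt_def by blast
  obtain K where K: "K > 0" "\<And>y. y \<in> S \<Longrightarrow> norm y \<le> K"
    using assms(2) unfolding bounded_pos by blast
  have \<gamma>K: "\<gamma> \<in> class_K"
    using \<gamma> by (simp add: class_K_inf_def)
  show thesis
  \<comment> \<open>Here 1 is the chosen \<open>\<epsilon>\<close>, and \<open>K\<close> converts
    distance to \<open>S\<close> into norm.\<close>
  proof (rule that[of "\<lambda>p. 1 + \<gamma> p + K"])
    show "mono_on {0..} (\<lambda>p. 1 + \<gamma> p + K)"
      using class_K_mono[OF \<gamma>K] by (auto simp: mono_on_def)
    show "0 \<le> 1 + \<gamma> p + K" if "p \<ge> 0" for p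
      using class_K_nonneg[OF \<gamma>K that] K(1) by simp
    show "recurrent \<phi> (\<lambda>p. 1 + \<gamma> p + K)"
      unfolding recurrent_def
    proof safe
      fix r :: real assume "r > 0"
      then obtain \<tau> where \<tau>: "\<And>u x. u \<in> PC \<Longrightarrow> infdist x S \<le> r + K \<Longrightarrow>
          \<exists>t\<in>{0..\<tau>}. infdist (\<phi> t x u) S \<le> 1 + \<gamma> (input_norm u)"
        using lim[of "r + K"] K(1) by auto
      have "\<exists>t\<in>{0..\<tau>}. norm (\<phi> t x u) \<le> 1 + \<gamma> (input_norm u) + K" if u: "u \<in> PC" and x: "norm x \<le> r" for x u
      proof -
        have "infdist x S \<le> r + K"
          using infdist_le_norm[OF K(2) assms(3), of x] x by simp
        then obtain t where t: "t \<in> {0..\<tau>}" "infdist (\<phi> t x u) S \<le> 1 + \<gamma> (input_norm u)"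
          using \<tau>[OF u] by blast
        then show ?thesis
          using norm_le_infdist[OF K(2) assms(3), of "\<phi> t x u"] by force
      qed
      then show "\<exists>\<tau>. \<forall>u\<in>PC. \<forall>x. norm x \<le> r \<longrightarrow>
          (\<exists>t\<in>{0..\<tau>}. norm (\<phi> t x u) \<le> 1 + \<gamma> (input_norm u) + K)"
        by blast
    qed
  qed
qed

text \<open>Collects what the rest of the argument takes from the mild flow; the semigroup and the
  nonlinearity no longer appear.\<close>

locale control_system =
  fixes \<phi> :: "real \<Rightarrow> 'a::real_normed_vector \<Rightarrow> (real \<Rightarrow> 'u::real_normed_vector) \<Rightarrow> 'a"
  assumes flow_concat: "\<And>u v s t x. u \<in> PC \<Longrightarrow> v \<in> PC \<Longrightarrow> s \<ge> 0 \<Longrightarrow> t \<ge> 0 \<Longrightarrow>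
      \<phi> (s + t) x (concat_input s u v) = \<phi> t (\<phi> s x u) v"
    and flow_lipschitz: "\<And>C \<tau>. C > 0 \<Longrightarrow> \<tau> > 0 \<Longrightarrow> \<exists>L\<ge>0. \<forall>x y. \<forall>u\<in>PC. \<forall>t\<in>{0..\<tau>}.
      norm x \<le> C \<longrightarrow> norm y \<le> C \<longrightarrow> input_norm u \<le> C \<longrightarrow>
      norm (\<phi> t x u - \<phi> t y u) \<le> L * norm (x - y)"
    and BRS: "BRS \<phi>"
begin

text \<open>An input is the concatenation of itself with its own tail, so the cocycle law restarts
  the flow at time \<open>s\<close>.\<close>

lemma flow_shift:
  assumes "u \<in> PC" "s \<ge> 0" "t \<ge> s"
  shows "\<phi> t x u = \<phi> (t - s) (\<phi> s x u) (\<lambda>r. u (r + s))"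
  using flow_concat[OF assms(1) PC_shift[OF assms(1,2)] assms(2), of "t - s" x] assms(3)
  by (simp add: concat_input_shift)

text \<open>
  Return times are only known to lie in \<open>[0, \<tau>]\<close> and may be zero; flowing one time unit first
  forces progress, so that finitely many returns reach any given time.
\<close>

lemma uniformly_bounded:
  assumes \<rho>: "recurrent \<phi> \<rho>" "mono_on {0..} \<rho>" and "C > 0"
  obtains M where "\<And>t x u. t \<ge> 0 \<Longrightarrow> norm x \<le> C \<Longrightarrow> u \<in> PC \<Longrightarrow> input_norm u \<le> C \<Longrightarrow>
    norm (\<phi> t x u) \<le> M"
proof -
  \<comment> \<open>This radius covers both the initial states and the states reached at a return,
    so each round starts from the same ball.\<close>
  define C' where "C' = max C (\<rho> C)"
  have "C' > 0" using \<open>C > 0\<close> by (simp add: C'_def)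
  obtain B where B: "\<And>t x u. norm x \<le> C' \<Longrightarrow> u \<in> PC \<Longrightarrow> input_norm u \<le> C' \<Longrightarrow> t \<in> {0..1} \<Longrightarrow>
      norm (\<phi> t x u) \<le> B"
    using BRS_bound[OF BRS \<open>C' > 0\<close> zero_less_one] by blast
  have "max B 1 > 0" by simp
  then obtain \<tau> where \<tau>: "\<And>u x. u \<in> PC \<Longrightarrow> norm x \<le> max B 1 \<Longrightarrow>
      \<exists>t\<in>{0..\<tau>}. norm (\<phi> t x u) \<le> \<rho> (input_norm u)"
    using \<rho>(1) unfolding recurrent_def by meson
  \<comment> \<open>The longest duration of one round: a unit of time followed by a return.\<close>
  have "1 + max 0 \<tau> > 0" by simp
  then obtain M where M: "\<And>t x u. norm x \<le> C' \<Longrightarrow> u \<in> PC \<Longrightarrow> input_norm u \<le> C' \<Longrightarrow>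
      t \<in> {0..1 + max 0 \<tau>} \<Longrightarrow> norm (\<phi> t x u) \<le> M"
    using BRS_bound[OF BRS \<open>C' > 0\<close>] by blast
  \<comment> \<open>Induction on the number of time units. A round lasts at least one unit, so after
    a return at most \<open>n\<close> units remain, with the shifted input still bounded by
    \<open>C\<close>.\<close>
  have bound: "norm (\<phi> t x u) \<le> M"
    if "0 \<le> t" "t \<le> real n" "norm x \<le> C'" "u \<in> PC" "input_norm u \<le> C" for n t x u
    using that
  proof (induction n arbitrary: t x u)
    case 0
    then show ?case by (intro M) (auto simp: C'_def)
  next
    case (Suc n)
    have uC': "input_norm u \<le> C'"
      using Suc.prems by (simp add: C'_def)
    show ?case
    proof (cases "t \<le> 1 + max 0 \<tau>")
      case True
      then show ?thesis using Suc.prems uC' by (intro M) auto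
    next
      case False
      let ?v = "\<lambda>r. u (r + 1)"
      have v: "?v \<in> PC" "input_norm ?v \<le> C"
        using PC_shift[of u 1] input_norm_shift[of u 1] Suc.prems by auto
      have "norm (\<phi> 1 x u) \<le> max B 1"
        using B[of x u 1] Suc.prems uC' by auto
      then obtain r where r: "r \<in> {0..\<tau>}" "norm (\<phi> r (\<phi> 1 x u) ?v) \<le> \<rho> (input_norm ?v)"
        using \<tau>[OF v(1)] by blast
      let ?w = "\<lambda>q. ?v (q + r)"
      have w: "?w \<in> PC" "input_norm ?w \<le> C"
        using PC_shift[OF v(1), of r] input_norm_shift[OF v(1), of r] v(2) r(1) by auto
      have "\<rho> (input_norm ?v) \<le> \<rho> C"
        using \<rho>(2) input_norm_nonneg[OF v(1)] v(2) \<open>C > 0\<close> by (auto simp: mono_on_def)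
      then have "norm (\<phi> (t - 1 - r) (\<phi> r (\<phi> 1 x u) ?v) ?w) \<le> M"
        using r w False Suc.prems(2) by (intro Suc.IH) (auto simp: C'_def)
      moreover have "\<phi> t x u = \<phi> (t - 1 - r) (\<phi> r (\<phi> 1 x u) ?v) ?w"
        using flow_shift[OF Suc.prems(4), of 1 t x] flow_shift[OF v(1), of r "t - 1" "\<phi> 1 x u"]
          False r(1) by simp
      ultimately show ?thesis by simp
    qed
  qed
  show thesis
  proof (rule that[of M])
    fix t :: real and x :: 'a and u :: "real \<Rightarrow> 'u"
    assume "0 \<le> t" "norm x \<le> C" "u \<in> PC" "input_norm u \<le> C"
    then show "norm (\<phi> t x u) \<le> M"
      using bound[of t "nat \<lceil>t\<rceil>" x u] by (simp add: C'_def real_nat_ceiling_ge)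
  qed
qed

section \<open>Reachable sets, their invariance, and ISS with respect to them\<close>

definition reach :: "real \<Rightarrow> real \<Rightarrow> 'a set" where
  "reach R s = {\<phi> t x u | t x u. t \<ge> 0 \<and> norm x \<le> R \<and> u \<in> PC \<and> input_norm u \<le> s}"

lemma reachI: "t \<ge> 0 \<Longrightarrow> norm x \<le> R \<Longrightarrow> u \<in> PC \<Longrightarrow> input_norm u \<le> s \<Longrightarrow> \<phi> t x u \<in> reach R s"
  unfolding reach_def by blast

lemma s_invariant_reach: "s_invariant \<phi> s (reach R s)"
  unfolding s_invariant_def
proof safe
  fix t :: real and y :: 'a and v :: "real \<Rightarrow> 'u"
  assume t: "t \<ge> 0" and v: "v \<in> PC" "input_norm v \<le> s" and "y \<in> reach R s"
  then obtain r x u where y: "y = \<phi> r x u" "r \<ge> 0" "norm x \<le> R" "u \<in> PC" "input_norm u \<le> s"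
    unfolding reach_def by blast
  then have "\<phi> t y v = \<phi> (r + t) x (concat_input r u v)"
    using flow_concat[of u v r t x] t v by simp
  also have "\<dots> \<in> reach R s"
    using y t v by (intro reachI PC_concat input_norm_concat) auto
  finally show "\<phi> t y v \<in> reach R s" .
qed

text \<open>Compare with the trajectory starting at \<open>y\<close> in \<open>S\<close> under the
  same input: it stays in \<open>S\<close> by invariance, so the Lipschitz estimate bounds the
  distance to \<open>S\<close>. Then take the infimum over \<open>y\<close>. The constant
  \<open>L + 1\<close> is positive, which permits the division.\<close>

lemma infdist_flow_lipschitz:
  assumes inv: "s_invariant \<phi> s S" and S: "S \<noteq> {}" "\<And>y. y \<in> S \<Longrightarrow> norm y \<le> C" and C: "C > 0" "\<tau> > 0"
  obtains L where "L > 0" "\<And>t x u. t \<in> {0..\<tau>} \<Longrightarrow> norm x \<le> C \<Longrightarrow> u \<in> PC \<Longrightarrow> input_norm u \<le> C \<Longrightarrow>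
    input_norm u \<le> s \<Longrightarrow> infdist (\<phi> t x u) S \<le> L * infdist x S"
proof -
  obtain L where L: "L \<ge> 0" "\<And>x y u t. u \<in> PC \<Longrightarrow> t \<in> {0..\<tau>} \<Longrightarrow> norm x \<le> C \<Longrightarrow> norm y \<le> C \<Longrightarrow>
      input_norm u \<le> C \<Longrightarrow> norm (\<phi> t x u - \<phi> t y u) \<le> L * norm (x - y)"
    using flow_lipschitz[OF C] by meson
  show thesis
  proof (rule that[of "L + 1"])
    fix t :: real and x :: 'a and u :: "real \<Rightarrow> 'u"
    assume *: "t \<in> {0..\<tau>}" "norm x \<le> C" "u \<in> PC" "input_norm u \<le> C" "input_norm u \<le> s"
    have "infdist (\<phi> t x u) S / (L + 1) \<le> infdist x S"
    proof (rule infdist_geI[OF S(1)])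
      fix y assume y: "y \<in> S"
      then have "\<phi> t y u \<in> S"
        using inv * by (simp add: s_invariant_def)
      then have "infdist (\<phi> t x u) S \<le> norm (\<phi> t x u - \<phi> t y u)"
        using infdist_le by (metis dist_norm)
      also have "\<dots> \<le> L * norm (x - y)"
        using * S(2)[OF y] by (intro L)
      also have "\<dots> \<le> dist x y * (L + 1)"
        by (simp add: dist_norm algebra_simps)
      finally show "infdist (\<phi> t x u) S / (L + 1) \<le> dist x y"
        using L(1) by (simp add: pos_divide_le_eq)
    qed
    then show "infdist (\<phi> t x u) S \<le> (L + 1) * infdist x S"
      using L(1) by (simp add: pos_divide_le_eq mult.commute)
  qed (use L in simp)
qed

lemma recurrent_imp_ISS:
  assumes \<rho>: "recurrent \<phi> \<rho>" "mono_on {0..} \<rho>" "\<And>p. p \<ge> 0 \<Longrightarrow> \<rho> p \<ge> 0" and s: "s > 0"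
  shows "\<exists>S. bounded S \<and> S \<noteq> {} \<and> s_invariant \<phi> s S \<and> ISS_wrt \<phi> S"
proof -
  define S where "S = reach (\<rho> s) s"
  have inv: "s_invariant \<phi> s S"
    unfolding S_def by (rule s_invariant_reach)
  have "(\<lambda>_. 0) \<in> PC" "input_norm (\<lambda>_. 0) \<le> s"
    using s by (auto simp: PC_def image_constant_conv intro: input_norm_le)
  then have "\<phi> 0 0 (\<lambda>_. 0) \<in> S"
    unfolding S_def using s \<rho>(3) by (intro reachI) auto
  then have Sne: "S \<noteq> {}" by blast
  have "max s (\<rho> s) > 0" using s by simp
  then obtain M where M: "\<And>t x u. t \<ge> 0 \<Longrightarrow> norm x \<le> max s (\<rho> s) \<Longrightarrow> u \<in> PC \<Longrightarrow>
      input_norm u \<le> max s (\<rho> s) \<Longrightarrow> norm (\<phi> t x u) \<le> M"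
    using uniformly_bounded[OF \<rho>(1,2)] by blast
  define K where "K = \<bar>M\<bar>"
  have K: "norm y \<le> K" if y: "y \<in> S" for y
  proof -
    obtain t x u where *: "y = \<phi> t x u" "t \<ge> 0" "norm x \<le> \<rho> s" "u \<in> PC" "input_norm u \<le> s"
      using y unfolding S_def reach_def by blast
    then have "norm (\<phi> t x u) \<le> M"
      by (intro M) auto
    then show ?thesis
      using *(1) by (simp add: K_def)
  qed
  have K0: "K \<ge> 0" by (simp add: K_def)
  note near = norm_le_infdist[OF K Sne] and far = infdist_le_norm[OF K Sne]

  \<comment> \<open>The two alternatives for \<open>x\<close> are the uses to come: initial states
    at distance at most \<open>C\<close> from \<open>S\<close>, and return points under an input of
    norm at most \<open>p\<close>.\<close>
  let ?Q = "\<lambda>C m. \<forall>p\<le>C. \<forall>t\<ge>0. \<forall>x. \<forall>u\<in>PC. input_norm u \<le> p \<longrightarrow>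
    (norm x \<le> C + K \<or> norm x \<le> \<rho> p) \<longrightarrow> infdist (\<phi> t x u) S \<le> m"
  obtain h where h: "continuous_on {0..} h" "mono_on {0..} h" "\<And>r. r \<ge> 0 \<Longrightarrow> h r \<ge> 0"
    and hQ: "\<And>r. r \<ge> 0 \<Longrightarrow> ?Q r (h r)"
  proof (rule continuous_majorant[of ?Q])
    fix C :: real assume "C > 0"
    define D where "D = max (C + K) (\<rho> C)"
    have "D > 0" using \<open>C > 0\<close> K0 by (simp add: D_def)
    then obtain M where M: "\<And>t x u. t \<ge> 0 \<Longrightarrow> norm x \<le> D \<Longrightarrow> u \<in> PC \<Longrightarrow> input_norm u \<le> D \<Longrightarrow>
        norm (\<phi> t x u) \<le> M"
      using uniformly_bounded[OF \<rho>(1,2)] by blast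
    have "infdist (\<phi> t x u) S \<le> M + K"
      if "p \<le> C" "t \<ge> 0" "u \<in> PC" "input_norm u \<le> p" "norm x \<le> C + K \<or> norm x \<le> \<rho> p" for p t x u
    proof -
      have "\<rho> p \<le> \<rho> C"
        using that input_norm_nonneg[OF that(3)] \<rho>(2) by (auto simp: mono_on_def)
      then have "norm (\<phi> t x u) \<le> M"
        using that K0 by (intro M) (auto simp: D_def)
      then show ?thesis using far[of "\<phi> t x u"] by simp
    qed
    then show "\<exists>m. ?Q C m" by blast
  next
    fix C C' m m' :: real assume *: "?Q C m" "C' \<le> C" "m \<le> m'"
    show "?Q C' m'"
    proof (intro allI ballI impI)
      fix p t :: real and x :: 'a and u :: "real \<Rightarrow> 'u"
      assume **: "p \<le> C'" "0 \<le> t" "u \<in> PC" "input_norm u \<le> p"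
        "norm x \<le> C' + K \<or> norm x \<le> \<rho> p"
      then have "p \<le> C" "norm x \<le> C + K \<or> norm x \<le> \<rho> p" using *(2) by auto
      then have "infdist (\<phi> t x u) S \<le> m" using *(1) **(2-4) by blast
      then show "infdist (\<phi> t x u) S \<le> m'" using *(3) by simp
    qed
  qed (rule that)

  \<comment> \<open>For \<open>p \<ge> s\<close> the factor \<open>p / s\<close> is at least 1, so
    \<open>\<gamma> p\<close> dominates the uniform bound \<open>h p\<close>.\<close>
  define \<gamma> where "\<gamma> = (\<lambda>p. p * (1 + h p / s))"
  have \<gamma>: "\<gamma> \<in> class_K_inf"
    unfolding \<gamma>_def
    by (rule class_K_inf_mult) (use h s in \<open>auto intro!: continuous_intros simp: mono_on_def divide_right_mono\<close>)
  have \<gamma>_nonneg: "\<gamma> (input_norm u) \<ge> 0" if "u \<in> PC" for u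
    using class_K_nonneg[of \<gamma>] \<gamma> input_norm_nonneg[OF that] by (simp add: class_K_inf_def)
  \<comment> \<open>The bound \<open>p\<close> is kept apart from the norm of \<open>u\<close>:
    after a return the remaining input may be smaller than the original one, whose norm is then
    \<open>p\<close>.\<close>
  have large_input: "infdist (\<phi> t x u) S \<le> \<gamma> p"
    if "p \<ge> s" "t \<ge> 0" "u \<in> PC" "input_norm u \<le> p" "norm x \<le> p + K \<or> norm x \<le> \<rho> p" for p t x u
  proof -
    have "infdist (\<phi> t x u) S \<le> h p"
      using hQ[of p] that s by auto
    also have "s * h p \<le> p * h p"
      using that s h(3)[of p] by (intro mult_right_mono) auto
    then have "h p \<le> p * h p / s"
      using s by (simp add: field_simps)
    also have "\<dots> \<le> \<gamma> p"
      using that s by (simp add: \<gamma>_def algebra_simps)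
    finally show ?thesis .
  qed

  \<comment> \<open>Covers all inputs except those exceeding both \<open>s\<close> and the initial
    distance, which fall under \<open>large_input\<close>.\<close>
  let ?P = "\<lambda>C m. \<forall>t\<ge>0. \<forall>x. \<forall>u\<in>PC. infdist x S \<le> C \<longrightarrow>
    (input_norm u \<le> s \<or> input_norm u \<le> infdist x S) \<longrightarrow>
    infdist (\<phi> t x u) S \<le> m * (exp (- t) * infdist x S) + \<gamma> (input_norm u)"
  obtain k where k: "continuous_on {0..} k" "mono_on {0..} k" "\<And>r. r \<ge> 0 \<Longrightarrow> k r \<ge> 0"
    and kP: "\<And>r. r \<ge> 0 \<Longrightarrow> ?P r (k r)"
  proof (rule continuous_majorant[of ?P])
    fix C :: real assume "C > 0"
    \<comment> \<open>One radius for the inputs (at most \<open>s\<close> or \<open>C\<close>), the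
      initial states (at most \<open>C + K\<close>) and the points of \<open>S\<close> (at most
      \<open>K\<close>).\<close>
    define D where "D = max s C + K"
    have D: "D > 0" "s \<le> D" "C \<le> D" "C + K \<le> D" "K \<le> D" using s K0 by (auto simp: D_def)
    obtain M where M: "\<And>t x u. t \<ge> 0 \<Longrightarrow> norm x \<le> D \<Longrightarrow> u \<in> PC \<Longrightarrow> input_norm u \<le> D \<Longrightarrow>
        norm (\<phi> t x u) \<le> M"
      using uniformly_bounded[OF \<rho>(1,2) D(1)] by blast
    obtain \<tau>' where \<tau>': "\<And>u x. u \<in> PC \<Longrightarrow> norm x \<le> D \<Longrightarrow>
        \<exists>t\<in>{0..\<tau>'}. norm (\<phi> t x u) \<le> \<rho> (input_norm u)"
      using \<rho>(1) D(1) unfolding recurrent_def by meson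
    define \<tau> where "\<tau> = max 1 \<tau>'"
    have "\<tau> > 0" by (simp add: \<tau>_def)
    have KD: "norm y \<le> D" if "y \<in> S" for y
      using K[OF that] D by simp
    obtain L where L: "L > 0" "\<And>t x u. t \<in> {0..\<tau>} \<Longrightarrow> norm x \<le> D \<Longrightarrow> u \<in> PC \<Longrightarrow> input_norm u \<le> D \<Longrightarrow>
        input_norm u \<le> s \<Longrightarrow> infdist (\<phi> t x u) S \<le> L * infdist x S"
      using infdist_flow_lipschitz[OF inv Sne KD D(1) \<open>\<tau> > 0\<close>] by blast
    \<comment> \<open>\<open>L\<close> serves inputs up to \<open>s\<close>. For a larger input the
      initial distance exceeds \<open>s\<close>, so the constant bound
      \<open>\<bar>M\<bar> + K\<close> is at most \<open>(\<bar>M\<bar> + K) / s\<close> times that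
      distance.\<close>
    define c where "c = L + (\<bar>M\<bar> + K) / s"
    have c: "L \<le> c" "(\<bar>M\<bar> + K) / s \<le> c" "c \<ge> 0"
      using L(1) K0 s by (auto simp: c_def)
    have "infdist (\<phi> t x u) S \<le> c * exp \<tau> * (exp (- t) * infdist x S) + \<gamma> (input_norm u)"
      if t: "t \<ge> 0" and u: "u \<in> PC" and x: "infdist x S \<le> C"
        and small: "input_norm u \<le> s \<or> input_norm u \<le> infdist x S" for t x u
    proof -
      have uD: "input_norm u \<le> D" and xD: "norm x \<le> D"
        using small x D near[of x] by auto
      show ?thesis
      proof (cases "t \<le> \<tau>")
        case True
        have "infdist (\<phi> t x u) S \<le> c * infdist x S"
        proof (cases "input_norm u \<le> s")
          case True
          then have "infdist (\<phi> t x u) S \<le> L * infdist x S"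
            using t \<open>t \<le> \<tau>\<close> u uD xD by (intro L) auto
          also have "\<dots> \<le> c * infdist x S"
            using c by (intro mult_right_mono infdist_nonneg)
          finally show ?thesis .
        next
          case False
          have "infdist (\<phi> t x u) S \<le> \<bar>M\<bar> + K"
            using far[of "\<phi> t x u"] M[OF t xD u uD] by simp
          also have "\<dots> = (\<bar>M\<bar> + K) / s * s"
            using s by simp
          also have "\<dots> \<le> c * infdist x S"
            using c False small s by (intro mult_mono) auto
          finally show ?thesis .
        qed
        also have "\<dots> = c * 1 * infdist x S" by simp
        \<comment> \<open>The inserted factor is \<open>exp (\<tau> - t)\<close>, at least 1 before
          time \<open>\<tau>\<close>.\<close>
        also have "\<dots> \<le> c * (exp \<tau> * exp (- t)) * infdist x S"
          using True c by (intro mult_right_mono mult_left_mono infdist_nonneg) (simp_all flip: exp_add)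
        finally show ?thesis
          using \<gamma>_nonneg[OF u] by (simp add: mult_ac)
      next
        case False
        obtain r where r: "r \<in> {0..\<tau>'}" "norm (\<phi> r x u) \<le> \<rho> (input_norm u)"
          using \<tau>'[OF u xD] by blast
        then have r0: "r \<ge> 0" "r \<le> t" using False by (auto simp: \<tau>_def)
        let ?v = "\<lambda>q. u (q + r)"
        have v: "?v \<in> PC" "input_norm ?v \<le> input_norm u"
          using PC_shift[OF u r0(1)] input_norm_shift[OF u r0(1)] by auto
        have eq: "\<phi> t x u = \<phi> (t - r) (\<phi> r x u) ?v"
          using flow_shift[OF u r0] .
        \<comment> \<open>A return has occurred by now. For inputs up to \<open>s\<close> the
          trajectory has been in \<open>S\<close> ever since, at distance zero; for larger ones
          \<open>large_input\<close> applies from the return point.\<close>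
        have "infdist (\<phi> t x u) S \<le> \<gamma> (input_norm u)"
        proof (cases "input_norm u \<le> s")
          case True
          then have "\<rho> (input_norm u) \<le> \<rho> s"
            using \<rho>(2) input_norm_nonneg[OF u] by (auto simp: mono_on_def)
          then have "\<phi> t x u \<in> S"
            unfolding S_def eq using r r0 v True by (intro reachI) auto
          then show ?thesis using \<gamma>_nonneg[OF u] by simp
        next
          case False
          then show ?thesis
            unfolding eq using r r0 v by (intro large_input) auto
        qed
        moreover have "0 \<le> c * exp \<tau> * (exp (- t) * infdist x S)"
          using c by (simp add: infdist_nonneg)
        ultimately show ?thesis by simp
      qed
    qed
    then show "\<exists>m. ?P C m" by blast
  next
    fix C C' m m' :: real assume *: "?P C m" "C' \<le> C" "m \<le> m'"
    show "?P C' m'"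
    proof (intro allI ballI impI)
      fix t :: real and x :: 'a and u :: "real \<Rightarrow> 'u"
    assume **: "0 \<le> t" "u \<in> PC" "infdist x S \<le> C'"
        "input_norm u \<le> s \<or> input_norm u \<le> infdist x S"
      then have "infdist x S \<le> C" using *(2) by simp
      then have "infdist (\<phi> t x u) S \<le> m * (exp (- t) * infdist x S) + \<gamma> (input_norm u)"
        using *(1) **(1,2,4) by blast
      moreover have "m * (exp (- t) * infdist x S) \<le> m' * (exp (- t) * infdist x S)"
        using *(3) by (intro mult_right_mono) (simp_all add: infdist_nonneg)
      ultimately show "infdist (\<phi> t x u) S \<le> m' * (exp (- t) * infdist x S) + \<gamma> (input_norm u)"
        by linarith
    qed
  qed (rule that)

  define \<beta> where "\<beta> = (\<lambda>r t. r * (1 + k r) * exp (- t))"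
  have "\<beta> \<in> class_KL"
    unfolding \<beta>_def using class_K_inf_mult[OF k]
    by (intro class_KL_exp) (simp add: class_K_inf_def)
  moreover have "infdist (\<phi> t x u) S \<le> \<beta> (infdist x S) t + \<gamma> (input_norm u)"
    if "u \<in> PC" "t \<ge> 0" for x u t
  proof (cases "input_norm u \<le> s \<or> input_norm u \<le> infdist x S")
    case True
    then have "infdist (\<phi> t x u) S \<le> k (infdist x S) * (exp (- t) * infdist x S) + \<gamma> (input_norm u)"
      using kP[OF infdist_nonneg[of x S]] that by blast
    also have "\<dots> \<le> \<beta> (infdist x S) t + \<gamma> (input_norm u)"
      by (simp add: \<beta>_def algebra_simps infdist_nonneg)
    finally show ?thesis .
  next
    case False
    then have "infdist (\<phi> t x u) S \<le> \<gamma> (input_norm u)"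
      using that near[of x] by (intro large_input) auto
    moreover have "0 \<le> \<beta> (infdist x S) t"
      using k(3) by (simp add: \<beta>_def infdist_nonneg)
    ultimately show ?thesis by simp
  qed
  ultimately have "ISS_wrt \<phi> S"
    unfolding ISS_wrt_def using \<gamma> by blast
  moreover have "bounded S"
    using K by (auto simp: bounded_iff)
  ultimately show ?thesis
    using inv Sne by blast
qed

end

lemma ISS_imp_ISpS:
  assumes "bounded S" "S \<noteq> {}" "ISS_wrt \<phi> S"
  shows "ISpS \<phi>"
proof -
  obtain \<beta> \<gamma> where \<beta>\<gamma>: "\<beta> \<in> class_KL" "\<gamma> \<in> class_K_inf" "\<And>x u t. u \<in> PC \<Longrightarrow> t \<ge> 0 \<Longrightarrow>
      infdist (\<phi> t x u) S \<le> \<beta> (infdist x S) t + \<gamma> (input_norm u)"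
    using assms(3) unfolding ISS_wrt_def by blast
  then have "infdist (\<phi> t x u) S \<le> \<beta> (infdist x S) t + \<gamma> (input_norm u) + 1"
    if "u \<in> PC" "t \<ge> 0" for x u t
    using that by (metis add_increasing2 zero_le_one)
  then have "ISpS_wrt \<phi> S"
    unfolding ISpS_wrt_def using \<beta>\<gamma>(1,2) zero_less_one by blast
  then show ?thesis
    unfolding ISpS_def using assms by blast
qed

section \<open>The equivalence\<close>

theorem mainTheorem6:
  fixes T :: "real \<Rightarrow> 'a::banach \<Rightarrow> 'a"
    and D :: "'a set" and A :: "'a \<Rightarrow> 'a"
    and f :: "'a \<Rightarrow> 'u::real_normed_vector \<Rightarrow> 'a"
  assumes "C0_semigroup T"
    and "generator_of D A T"
    and "lipschitz_on_bounded f"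
    and "\<And>x. continuous_on UNIV (f x)"
    and "unique_global_solutions T f"
    and "BRS (mild_flow T f)"
  shows "(ISpS (mild_flow T f) \<longleftrightarrow>
          (\<forall>s>0. \<exists>S. bounded S \<and> S \<noteq> {} \<and> s_invariant (mild_flow T f) s S \<and>
             ISS_wrt (mild_flow T f) S)) \<and>
         ((\<forall>s>0. \<exists>S. bounded S \<and> S \<noteq> {} \<and> s_invariant (mild_flow T f) s S \<and>
             ISS_wrt (mild_flow T f) S) \<longleftrightarrow>
          (\<exists>S. bounded S \<and> S \<noteq> {} \<and> ULIM_wrt (mild_flow T f) S))"
    (is "(?i \<longleftrightarrow> ?ii) \<and> (?ii \<longleftrightarrow> ?iii)")
proof -
  interpret control_system "mild_flow T f"
    using assms mild_flow_concat mild_flow_lipschitz by unfold_locales blast+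
  have "?i \<Longrightarrow> ?iii"
    by (rule ISpS_imp_ULIM)
  moreover have "?iii \<Longrightarrow> ?ii"
    using ULIM_imp_recurrent recurrent_imp_ISS by metis
  \<comment> \<open>The choice \<open>s = 1\<close> suffices here and closes the cycle of
    implications.\<close>
  moreover have "?ii \<Longrightarrow> ?i"
    using ISS_imp_ISpS zero_less_one by blast
  ultimately show ?thesis by blast
qed

end
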